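(* Let $\{Y_k:k\in\mathbb{Z}\}$ be a centered stationary real Gaussian sequence whose spectral measure $\rho_Y$ has a continuous density $p_Y(\lambda)$, supported within $[-\pi,\pi]$. For $T\in\mathbb{N}$ let $$N_Y^\star(T):=\sum_{k=0}^{T-1}\mathbf{1}_{\{Y_kY_{k+1}<0\}}.$$ Then there exist a finite constant $C$ and a function $c:(0,\infty)\to(0,\infty)$ such that $$\mathbb{P}\big(|N_Y^\star(T)-\mathbb{E}N_Y^\star(T)|\ge\eta T\big)\le Ce^{-c(\eta)T}\qquad\text{for all }\eta>0\text{ and all }T\in\mathbb{N}.$$
   Context: The spectral measure of $\{Y_k\}$ is the finite symmetric measure $\rho_Y$ on $[-\pi,\pi]$ with $\mathbb{E}[Y_jY_{j+k}]=\int_{-\pi}^{\pi}e^{-i\lambda k}\,d\rho_Y(\lambda)$ for all $j,k\in\mathbb{Z}$; the density $p_Y$ is continuous on $[-\pi,\pi]$. *)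

theory Defs
  imports "HOL-Probability.Probability"
begin

text \<open>Degenerate (almost surely constant) variables count as Gaussian, so that the
  definition of a Gaussian family below also covers singular covariance matrices.\<close>

definition gaussian_rv :: "'a measure \<Rightarrow> ('a \<Rightarrow> real) \<Rightarrow> bool" where
  "gaussian_rv M X \<longleftrightarrow> X \<in> borel_measurable M \<and>
     ((\<exists>\<mu> \<sigma>. \<sigma> > 0 \<and> distributed M lborel X (\<lambda>x. ennreal (normal_density \<mu> \<sigma> x)))
      \<or> (\<exists>\<mu>. AE \<omega> in M. X \<omega> = \<mu>))"

text \<open>Joint Gaussianity: every finite linear combination is Gaussian.\<close>

definition gaussian_family :: "'a measure \<Rightarrow> ('i \<Rightarrow> 'a \<Rightarrow> real) \<Rightarrow> bool" where
  "gaussian_family M Y \<longleftrightarrow>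
     (\<forall>J a. finite J \<longrightarrow> gaussian_rv M (\<lambda>\<omega>. \<Sum>i\<in>J. a i * Y i \<omega>))"

definition centered :: "'a measure \<Rightarrow> ('i \<Rightarrow> 'a \<Rightarrow> real) \<Rightarrow> bool" where
  "centered M Y \<longleftrightarrow> (\<forall>i. integrable M (Y i) \<and> (LINT \<omega>|M. Y i \<omega>) = 0)"

text \<open>Strict stationarity: the law of the whole sequence on the product space is
  invariant under shifts.\<close>

definition stationary :: "'a measure \<Rightarrow> (int \<Rightarrow> 'a \<Rightarrow> real) \<Rightarrow> bool" where
  "stationary M Y \<longleftrightarrow> (\<forall>k. Y k \<in> borel_measurable M) \<and>
     (\<forall>h. distr M (\<Pi>\<^sub>M k\<in>UNIV. borel) (\<lambda>\<omega> k. Y (k + h) \<omega>)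
        = distr M (\<Pi>\<^sub>M k\<in>UNIV. borel) (\<lambda>\<omega> k. Y k \<omega>))"

text \<open>A measure on \<open>[-\<pi>, \<pi>]\<close> is represented as a Borel measure on the real line that
  gives no mass to the complement of that interval.\<close>

definition spectral_measure :: "'a measure \<Rightarrow> (int \<Rightarrow> 'a \<Rightarrow> real) \<Rightarrow> real measure \<Rightarrow> bool" where
  "spectral_measure M Y \<rho> \<longleftrightarrow>
     sets \<rho> = sets borel \<and> finite_measure \<rho> \<and>
     emeasure \<rho> (- {-pi..pi}) = 0 \<and>
     distr \<rho> borel uminus = \<rho> \<and>
     (\<forall>j k. complex_of_real (LINT \<omega>|M. Y j \<omega> * Y (j + k) \<omega>)
        = (LINT x:{-pi..pi}|\<rho>. exp (- (\<i> * complex_of_real x * of_int k))))"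

definition sign_changes :: "(int \<Rightarrow> 'a \<Rightarrow> real) \<Rightarrow> nat \<Rightarrow> 'a \<Rightarrow> real" where
  "sign_changes Y T \<omega> =
     (\<Sum>k = 0..<T. of_bool (Y (int k) \<omega> * Y (int k + 1) \<omega> < 0))"

end

theory Submission
  imports Defs
begin

text \<open>
  The number of sign changes is a discontinuous functional of the Gaussian vector
  \<open>(Y 0, \<dots>, Y T)\<close>, but it agrees with a Lipschitz functional up to an error that is itself bounded by a
  Lipschitz functional of small mean, and Lipschitz functionals of a Gaussian vector concentrate.

  The continuous spectral density is bounded on \<open>[-\<pi>, \<pi>]\<close>, say by \<open>S\<close>. Writing the variance of
  \<open>\<Sum>j. a j * Y j\<close> as the spectral integral of \<open>\<bar>\<Sum>j. a j * e\<^sup>i\<^sup>j\<^sup>x\<bar>\<^sup>2\<close> and using orthogonality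
  of the exponentials, it is at most \<open>2 * \<pi> * S * (\<Sum>j. (a j)\<^sup>2)\<close>
  (\<open>variance_le_spectral_density\<close>). So the covariance matrices of all the vectors
  \<open>(Y 0, \<dots>, Y T)\<close> have operator norm at most \<open>L = 2 * \<pi> * S\<close>, uniformly in \<open>T\<close>.

  For a function \<open>F\<close> with squared gradient at most \<open>G\<close>, the argument of Maurey and Pisier then gives
  \<open>P(\<bar>F(X) - E F(X)\<bar> \<ge> r) \<le> 2 * exp (- 2 * r\<^sup>2 / (\<pi>\<^sup>2 * L * G))\<close> (\<open>gaussian_concentration\<close>). Let
  \<open>X'\<close> be an independent copy of \<open>X\<close>. The path
  \<open>U\<^sub>\<theta> = cos \<theta> * X + sin \<theta> * X'\<close> joins \<open>X\<close> to \<open>X'\<close>, its velocity \<open>V\<^sub>\<theta>\<close> is Gaussian, and for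
  each \<open>\<theta>\<close> the pair \<open>(U\<^sub>\<theta>, V\<^sub>\<theta>)\<close> has the law of \<open>(X, X')\<close>. Hence, by Jensen's inequality along the path,
  the exponential moment of \<open>F(X') - F(X)\<close> is bounded by that of \<open>\<pi> / 2 * \<nabla>F(X) \<bullet> X'\<close>, which is
  an explicit Gaussian integral. The rotation invariance follows from a multivariate
  version of the uniqueness theorem for characteristic functions, which is
  obtained here from the one-dimensional theorem of Levy.

  Now let \<open>\<sigma>\<close> be the smooth sign function \<open>x / sqrt (x\<^sup>2 + d\<^sup>2)\<close>. The indicator of \<open>x * y < 0\<close> differs from
  \<open>(1 - \<sigma> x * \<sigma> y) / 2\<close> by at most \<open>((1 - \<sigma>(x)\<^sup>2) + (1 - \<sigma>(y)\<^sup>2)) / 2\<close>. Summed over the \<open>T\<close> pairs of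
  neighbours, the approximation and the error bound are both functionals with squared gradient of order \<open>T\<close>,
  so both have fluctuations of size \<open>\<eta> * T\<close> only with probability exponentially small in \<open>T\<close>. The mean of
  the error is \<open>T\<close> times \<open>E (1 - \<sigma>(Y 0)\<^sup>2)\<close> by stationarity. This factor tends to \<open>0\<close> with
  \<open>d\<close>, because a nondegenerate \<open>Y 0\<close> has no atom at \<open>0\<close>. It remains to choose \<open>d\<close> in
  terms of \<open>\<eta>\<close>. If \<open>Y 0\<close> is degenerate, then the sequence vanishes almost surely and there are no sign changes.
\<close>

section \<open>Multivariate uniqueness for characteristic functions\<close>

text \<open>
  Levy's theorem is about probability measures. A nonnegative weight \<open>u\<close> of positive mass is therefore
  absorbed into the law of \<open>X\<close> by normalising.
\<close>

lemma tilted_law: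
  fixes X u :: "'a \<Rightarrow> real"
  assumes M: "finite_measure M" and [measurable]: "X \<in> borel_measurable M" "u \<in> borel_measurable M"
    and u: "\<And>\<omega>. 0 \<le> u \<omega>" "\<And>\<omega>. u \<omega> \<le> K" and m: "m = (LINT \<omega>|M. u \<omega>)" "m > 0"
  defines "P \<equiv> distr (density M (\<lambda>\<omega>. ennreal (u \<omega> / m))) borel X"
  shows "real_distribution P"
    and "char P t = (CLINT \<omega>|M. u \<omega> *\<^sub>R cis (t * X \<omega>)) /\<^sub>R m"
    and "B \<in> sets borel \<Longrightarrow> measure P B = (LINT \<omega>|M. u \<omega> * indicator B (X \<omega>)) / m"
proof -
  interpret finite_measure M by fact
  have int: "integrable M u"
    by (rule integrable_const_bound[where B=K]) (use u in auto)
  have "emeasure (density M (\<lambda>\<omega>. ennreal (u \<omega> / m))) (space M) = (\<integral>\<^sup>+\<omega>. ennreal (u \<omega> / m) \<partial>M)"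
    by (subst emeasure_density) (auto intro!: nn_integral_cong)
  also have "\<dots> = ennreal (LINT \<omega>|M. u \<omega> / m)"
    by (rule nn_integral_eq_integral) (use int u m in auto)
  also have "\<dots> = 1" using m by simp
  finally have D: "prob_space (density M (\<lambda>\<omega>. ennreal (u \<omega> / m)))"
    by (intro prob_spaceI) simp
  show rd: "real_distribution P"
    unfolding P_def real_distribution_def real_distribution_axioms_def
    using prob_space.prob_space_distr[OF D, of X borel] by simp
  have "char P t = (CLINT x|P. cis (t * x))" by (simp add: char_def cis_conv_exp)
  also have "\<dots> = (CLINT \<omega>|M. (u \<omega> / m) *\<^sub>R cis (t * X \<omega>))"
    unfolding P_def cis_conv_exp using u m by (simp add: integral_distr integral_density)
  also have "\<dots> = (CLINT \<omega>|M. inverse m *\<^sub>R (u \<omega> *\<^sub>R cis (t * X \<omega>)))"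
    by (simp add: divide_inverse mult.commute)
  also have "\<dots> = (CLINT \<omega>|M. u \<omega> *\<^sub>R cis (t * X \<omega>)) /\<^sub>R m"
    by (simp del: scaleR_scaleR)
  finally show "char P t = (CLINT \<omega>|M. u \<omega> *\<^sub>R cis (t * X \<omega>)) /\<^sub>R m" .
  assume B[measurable]: "B \<in> sets borel"
  interpret P: real_distribution P by fact
  have "measure P B = (LINT x|P. indicator B x)" by simp
  also have "\<dots> = (LINT \<omega>|M. (u \<omega> / m) * indicator B (X \<omega>))"
    unfolding P_def using u m by (subst integral_distr, simp, simp) (subst integral_density, auto)
  also have "\<dots> = (LINT \<omega>|M. u \<omega> * indicator B (X \<omega>)) / m" by simp
  finally show "measure P B = (LINT \<omega>|M. u \<omega> * indicator B (X \<omega>)) / m" .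
qed

lemma weighted_char_uniqueness:
  fixes X u :: "'a \<Rightarrow> real" and X' u' :: "'b \<Rightarrow> real"
  assumes M: "finite_measure M" and N: "finite_measure N"
    and [measurable]: "X \<in> borel_measurable M" "u \<in> borel_measurable M"
       "X' \<in> borel_measurable N" "u' \<in> borel_measurable N"
    and u: "\<And>\<omega>. 0 \<le> u \<omega>" "\<And>\<omega>. u \<omega> \<le> K" and u': "\<And>\<omega>. 0 \<le> u' \<omega>" "\<And>\<omega>. u' \<omega> \<le> K"
    and eq: "\<And>t. (CLINT \<omega>|M. u \<omega> *\<^sub>R cis (t * X \<omega>)) = (CLINT \<omega>|N. u' \<omega> *\<^sub>R cis (t * X' \<omega>))"
    and B[measurable]: "B \<in> sets borel"
  shows "(LINT \<omega>|M. u \<omega> * indicator B (X \<omega>)) = (LINT \<omega>|N. u' \<omega> * indicator B (X' \<omega>))"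
proof -
  interpret M: finite_measure M by fact
  interpret N: finite_measure N by fact
  have int: "integrable M u" "integrable N u'"
    by (rule M.integrable_const_bound[where B=K] N.integrable_const_bound[where B=K]; use u u' in auto)+
  define m where "m = (LINT \<omega>|M. u \<omega>)"
  have "complex_of_real (LINT \<omega>|M. u \<omega>) = complex_of_real (LINT \<omega>|N. u' \<omega>)"
    using eq[of 0] by (simp add: scaleR_conv_of_real)
  then have m': "m = (LINT \<omega>|N. u' \<omega>)" by (simp add: m_def)
  have "m \<ge> 0" unfolding m_def using u by simp
  then consider "m = 0" | "m > 0" by linarith
  then show ?thesis
  proof cases
    case 1
    have "AE \<omega> in M. u \<omega> = 0" "AE \<omega> in N. u' \<omega> = 0"
      using 1 m_def m' int u u' integral_nonneg_eq_0_iff_AE[of M u] integral_nonneg_eq_0_iff_AE[of N u'] by auto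
    then have "(LINT \<omega>|M. u \<omega> * indicator B (X \<omega>)) = 0" "(LINT \<omega>|N. u' \<omega> * indicator B (X' \<omega>)) = 0"
      by (auto intro!: integral_eq_zero_AE)
    then show ?thesis by simp
  next
    case 2
    note TM = tilted_law[OF M \<open>X \<in> borel_measurable M\<close> \<open>u \<in> borel_measurable M\<close> u m_def 2]
    note TN = tilted_law[OF N \<open>X' \<in> borel_measurable N\<close> \<open>u' \<in> borel_measurable N\<close> u' m' 2]
    have "distr (density M (\<lambda>\<omega>. ennreal (u \<omega> / m))) borel X
        = distr (density N (\<lambda>\<omega>. ennreal (u' \<omega> / m))) borel X'"
      by (rule Levy_uniqueness[OF TM(1) TN(1)]) (auto simp: TM(2) TN(2) eq)
    with TM(3)[OF B] TN(3)[OF B] 2 show ?thesis by simp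
  qed
qed

text \<open>
  The factors \<open>cis (a i * X i)\<close> of a joint characteristic function are replaced one at a time by
  indicators \<open>X i \<in> A i\<close>. Replacing the factor of index \<open>k\<close> is a one-dimensional uniqueness question
  for \<open>X k\<close> under a complex weight, namely the product \<open>W\<close> of the earlier indicators times \<open>cis S\<close>, where \<open>S\<close> is
  the linear combination that remains. The real weights \<open>W * (1 + cos (S + c))\<close> are nonnegative and, for different
  \<open>c\<close>, determine the complex one; their transforms in \<open>X k\<close> are combinations of
  the integrals in the induction hypothesis.
\<close>

lemma swap_char_for_indicators:
  fixes X :: "'i \<Rightarrow> 'a \<Rightarrow> real" and X' :: "'i \<Rightarrow> 'b \<Rightarrow> real"
  assumes M: "finite_measure M" and N: "finite_measure N" and fin: "finite I" "finite K" "I \<inter> K = {}"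
    and [measurable]: "\<And>i. i \<in> I \<union> K \<Longrightarrow> X i \<in> borel_measurable M"
       "\<And>i. i \<in> I \<union> K \<Longrightarrow> X' i \<in> borel_measurable N"
    and eq: "\<And>a. (CLINT \<omega>|M. cis (\<Sum>i\<in>I \<union> K. a i * X i \<omega>)) = (CLINT \<omega>|N. cis (\<Sum>i\<in>I \<union> K. a i * X' i \<omega>))"
    and A: "\<And>i. i \<in> I \<Longrightarrow> A i \<in> sets borel"
  shows "(CLINT \<omega>|M. (\<Prod>i\<in>I. indicator (A i) (X i \<omega>) :: real) *\<^sub>R cis (\<Sum>i\<in>K. a i * X i \<omega>))
       = (CLINT \<omega>|N. (\<Prod>i\<in>I. indicator (A i) (X' i \<omega>) :: real) *\<^sub>R cis (\<Sum>i\<in>K. a i * X' i \<omega>))"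
  using fin assms(6-)
proof (induction I arbitrary: K a rule: finite_induct)
  case empty
  then show ?case by simp
next
  case (insert k I)
  interpret M: finite_measure M by fact
  interpret N: finite_measure N by fact
  note [measurable] = insert.prems(3,4,6)
  have Xm[measurable]: "X k \<in> borel_measurable M" "X' k \<in> borel_measurable N"
      "\<And>i. i \<in> K \<Longrightarrow> X i \<in> borel_measurable M" "\<And>i. i \<in> K \<Longrightarrow> X' i \<in> borel_measurable N"
      "\<And>i. i \<in> I \<Longrightarrow> X i \<in> borel_measurable M" "\<And>i. i \<in> I \<Longrightarrow> X' i \<in> borel_measurable N"
      "\<And>i. i \<in> I \<Longrightarrow> A i \<in> sets borel" "A k \<in> sets borel"
    using insert.prems by auto
  define W where "W \<omega> = (\<Prod>i\<in>I. indicator (A i) (X i \<omega>) :: real)" for \<omega>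
  define W' where "W' \<omega> = (\<Prod>i\<in>I. indicator (A i) (X' i \<omega>) :: real)" for \<omega>
  define S where "S a \<omega> = (\<Sum>i\<in>K. a i * X i \<omega>)" for a \<omega>
  define S' where "S' a \<omega> = (\<Sum>i\<in>K. a i * X' i \<omega>)" for a \<omega>
  have [measurable]: "W \<in> borel_measurable M" "W' \<in> borel_measurable N"
     "S a \<in> borel_measurable M" "S' a \<in> borel_measurable N" for a
    unfolding W_def[abs_def] W'_def[abs_def] S_def[abs_def] S'_def[abs_def] by measurable
  have W01: "0 \<le> W \<omega>" "W \<omega> \<le> 1" "0 \<le> W' \<omega>'" "W' \<omega>' \<le> 1" for \<omega> \<omega>'
    by (auto simp: W_def W'_def intro!: prod_nonneg prod_le_1)
  have k: "k \<notin> K" "finite K" "k \<notin> I" using insert by auto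
  have IH: "(CLINT \<omega>|M. W \<omega> *\<^sub>R cis (t * X k \<omega> + S a \<omega>)) = (CLINT \<omega>|N. W' \<omega> *\<^sub>R cis (t * X' k \<omega> + S' a \<omega>))" for t a
  proof -
    define b where "b = a(k := t)"
    have "(CLINT \<omega>|M. W \<omega> *\<^sub>R cis (\<Sum>i\<in>insert k K. b i * X i \<omega>)) = (CLINT \<omega>|N. W' \<omega> *\<^sub>R cis (\<Sum>i\<in>insert k K. b i * X' i \<omega>))"
      unfolding W_def W'_def by (rule insert.IH) (use insert in auto)
    moreover have "(\<Sum>i\<in>insert k K. b i * X i \<omega>) = t * X k \<omega> + S a \<omega>" for \<omega>
      using k by (auto simp: b_def S_def intro!: sum.cong)
    moreover have "(\<Sum>i\<in>insert k K. b i * X' i \<omega>) = t * X' k \<omega> + S' a \<omega>" for \<omega>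
      using k by (auto simp: b_def S'_def intro!: sum.cong)
    ultimately show ?thesis by simp
  qed
  have intM: "integrable M (\<lambda>\<omega>. W \<omega> *\<^sub>R cis (f \<omega>))" if [measurable]: "f \<in> borel_measurable M" for f
    by (rule M.integrable_const_bound[where B=1]) (use W01 in \<open>auto simp: cis_conv_exp\<close>)
  have intN: "integrable N (\<lambda>\<omega>. W' \<omega> *\<^sub>R cis (f \<omega>))" if [measurable]: "f \<in> borel_measurable N" for f
    by (rule N.integrable_const_bound[where B=1]) (use W01 in \<open>auto simp: cis_conv_exp\<close>)
  define w where "w a c \<omega> = W \<omega> * (1 + cos (S a \<omega> + c))" for a c \<omega>
  define w' where "w' a c \<omega> = W' \<omega> * (1 + cos (S' a \<omega> + c))" for a c \<omega>
  \<comment> \<open>Euler's formula splits the weighted exponential into three pure exponentials, with phases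
    shifted by \<open>0\<close>, \<open>s\<close> and \<open>-s\<close>; these are all of the form covered by the induction hypothesis.\<close>
  have expand: "(1 + cos (s + c)) *\<^sub>R cis x
     = cis x + (cis c / 2) * cis (x + s) + (cis (-c) / 2) * cis (x - s)" for s c x :: real
  proof -
    have "complex_of_real (cos (s + c)) = (cis (s + c) + cis (-(s + c))) / 2"
      using cos_minus[of "s + c"] sin_minus[of "s + c"] by (simp add: complex_eq_iff del: cos_minus sin_minus minus_add_distrib)
    then have "(1 + cos (s + c)) *\<^sub>R cis x = cis x + (cis (s + c) * cis x + cis (-(s + c)) * cis x) / 2"
      by (simp add: scaleR_conv_of_real field_simps)
    also have "\<dots> = cis x + (cis c / 2) * cis (x + s) + (cis (-c) / 2) * cis (x - s)"
      by (simp add: cis_mult field_simps)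
    finally show ?thesis .
  qed
  have "(CLINT \<omega>|M. w a c \<omega> *\<^sub>R cis (t * X k \<omega>)) = (CLINT \<omega>|N. w' a c \<omega> *\<^sub>R cis (t * X' k \<omega>))" for a c t
  proof -
    have "(CLINT \<omega>|M. w a c \<omega> *\<^sub>R cis (t * X k \<omega>)) =
       (CLINT \<omega>|M. W \<omega> *\<^sub>R cis (t * X k \<omega>) + (cis c / 2) * (W \<omega> *\<^sub>R cis (t * X k \<omega> + S a \<omega>))
           + (cis (-c) / 2) * (W \<omega> *\<^sub>R cis (t * X k \<omega> - S a \<omega>)))"
      by (rule Bochner_Integration.integral_cong)
         (auto simp: w_def expand scaleR_scaleR[symmetric] scaleR_add_right simp del: scaleR_scaleR)
    also have "\<dots> = (CLINT \<omega>|M. W \<omega> *\<^sub>R cis (t * X k \<omega>)) + (cis c / 2) * (CLINT \<omega>|M. W \<omega> *\<^sub>R cis (t * X k \<omega> + S a \<omega>))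
           + (cis (-c) / 2) * (CLINT \<omega>|M. W \<omega> *\<^sub>R cis (t * X k \<omega> - S a \<omega>))"
      by (simp add: intM del: mult_scaleR_right)
    also have "\<dots> = (CLINT \<omega>|N. W' \<omega> *\<^sub>R cis (t * X' k \<omega>)) + (cis c / 2) * (CLINT \<omega>|N. W' \<omega> *\<^sub>R cis (t * X' k \<omega> + S' a \<omega>))
           + (cis (-c) / 2) * (CLINT \<omega>|N. W' \<omega> *\<^sub>R cis (t * X' k \<omega> - S' a \<omega>))"
      using IH[of t a] IH[of t "\<lambda>i. 0"] IH[of t "\<lambda>i. - a i"] by (simp add: S_def S'_def sum_negf)
    also have "\<dots> = (CLINT \<omega>|N. W' \<omega> *\<^sub>R cis (t * X' k \<omega>) + (cis c / 2) * (W' \<omega> *\<^sub>R cis (t * X' k \<omega> + S' a \<omega>))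
           + (cis (-c) / 2) * (W' \<omega> *\<^sub>R cis (t * X' k \<omega> - S' a \<omega>)))"
      by (simp add: intN del: mult_scaleR_right)
    also have "\<dots> = (CLINT \<omega>|N. w' a c \<omega> *\<^sub>R cis (t * X' k \<omega>))"
      by (rule Bochner_Integration.integral_cong)
         (auto simp: w'_def expand scaleR_scaleR[symmetric] scaleR_add_right simp del: scaleR_scaleR)
    finally show ?thesis .
  qed
  moreover have "0 \<le> w a c \<omega>" "w a c \<omega> \<le> 2" "0 \<le> w' a c \<omega>'" "w' a c \<omega>' \<le> 2" for a c \<omega> \<omega>'
  proof -
    have "0 \<le> 1 + cos x" "1 + cos x \<le> 2" for x :: real
      using cos_ge_minus_one[of x] cos_le_one[of x] by linarith+
    with W01 show "0 \<le> w a c \<omega>" "w a c \<omega> \<le> 2" "0 \<le> w' a c \<omega>'" "w' a c \<omega>' \<le> 2"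
      unfolding w_def w'_def using mult_mono[of "W \<omega>" 1 _ 2] mult_mono[of "W' \<omega>'" 1 _ 2] by auto
  qed
  ultimately have wB: "(LINT \<omega>|M. w a c \<omega> * indicator (A k) (X k \<omega>)) = (LINT \<omega>|N. w' a c \<omega> * indicator (A k) (X' k \<omega>))" for a c
    by (intro weighted_char_uniqueness[OF M N, where K=2]) (auto simp: w_def[abs_def] w'_def[abs_def])
  have split: "f * (1 + cos x) * g = g * f + g * f * cos x" for f g x :: real by (simp add: algebra_simps)
  define V where "V \<omega> = indicator (A k) (X k \<omega>) * W \<omega>" for \<omega>
  define V' where "V' \<omega> = indicator (A k) (X' k \<omega>) * W' \<omega>" for \<omega>
  have [measurable]: "V \<in> borel_measurable M" "V' \<in> borel_measurable N"
    unfolding V_def[abs_def] V'_def[abs_def] by measurable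
  have V01: "\<bar>V \<omega>\<bar> \<le> 1" "\<bar>V' \<omega>'\<bar> \<le> 1" for \<omega> \<omega>'
    using W01 by (auto simp: V_def V'_def indicator_def)
  have bcos: "\<bar>v * cos x\<bar> \<le> 1" if "\<bar>v\<bar> \<le> 1" for v x :: real
    using that mult_mono[of "\<bar>v\<bar>" 1 "\<bar>cos x\<bar>" 1] by (auto simp: abs_mult)
  have iM: "integrable M V" "integrable M (\<lambda>\<omega>. V \<omega> * cos (S a \<omega> + c))" for a c
    by (rule M.integrable_const_bound[where B=1]; use V01 bcos in auto)+
  have iN: "integrable N V'" "integrable N (\<lambda>\<omega>. V' \<omega> * cos (S' a \<omega> + c))" for a c
    by (rule N.integrable_const_bound[where B=1]; use V01 bcos in auto)+
  have wB': "(LINT \<omega>|M. V \<omega>) + (LINT \<omega>|M. V \<omega> * cos (S a \<omega> + c)) = (LINT \<omega>|N. V' \<omega>) + (LINT \<omega>|N. V' \<omega> * cos (S' a \<omega> + c))" for a c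
    using wB[of a c] iM iN by (simp add: w_def w'_def split V_def[symmetric] V'_def[symmetric])
  \<comment> \<open>The weight with \<open>S = 0\<close> and \<open>c = 0\<close> isolates the constant part; then \<open>c = 0\<close> and \<open>c = -\<pi>/2\<close> give the
    cosine and the sine of \<open>S\<close>.\<close>
  have V1: "(LINT \<omega>|M. V \<omega>) = (LINT \<omega>|N. V' \<omega>)"
    using wB'[of "\<lambda>_. 0" 0] by (simp add: S_def S'_def)
  have c: "(LINT \<omega>|M. V \<omega> * cos (S a \<omega> + c)) = (LINT \<omega>|N. V' \<omega> * cos (S' a \<omega> + c))" for a c
    using wB'[of a c] V1 by simp
  have cs: "(LINT \<omega>|M. V \<omega> * cos (S a \<omega>)) = (LINT \<omega>|N. V' \<omega> * cos (S' a \<omega>))"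
     "(LINT \<omega>|M. V \<omega> * sin (S a \<omega>)) = (LINT \<omega>|N. V' \<omega> * sin (S' a \<omega>))"
    using c[of a 0] c[of a "-(pi/2)"] by (simp_all add: cos_diff)
  have iM2: "integrable M (\<lambda>\<omega>. V \<omega> *\<^sub>R cis (S a \<omega>))"
    by (rule M.integrable_const_bound[where B=1]) (use V01 in \<open>auto simp: cis_conv_exp\<close>)
  have iN2: "integrable N (\<lambda>\<omega>. V' \<omega> *\<^sub>R cis (S' a \<omega>))"
    by (rule N.integrable_const_bound[where B=1]) (use V01 in \<open>auto simp: cis_conv_exp\<close>)
  have "(CLINT \<omega>|M. V \<omega> *\<^sub>R cis (S a \<omega>)) = (CLINT \<omega>|N. V' \<omega> *\<^sub>R cis (S' a \<omega>))"
    using cs iM2 iN2 by (auto simp: complex_eq_iff integral_Re[symmetric] integral_Im[symmetric]  simp del: integral_Re integral_Im)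
  then show ?case
    using k insert.hyps by (simp add: V_def V'_def W_def W'_def S_def S'_def)
qed

text \<open>
  Once every exponential has been traded for an indicator, the two laws agree on boxes, and boxes
  generate the product \<open>\<sigma>\<close>-algebra.
\<close>

lemma joint_char_determines_law:
  fixes X :: "'i \<Rightarrow> 'a \<Rightarrow> real" and X' :: "'i \<Rightarrow> 'b \<Rightarrow> real"
  assumes M: "prob_space M" and N: "prob_space N" and J: "finite J"
    and [measurable]: "\<And>i. i \<in> J \<Longrightarrow> X i \<in> borel_measurable M" "\<And>i. i \<in> J \<Longrightarrow> X' i \<in> borel_measurable N"
    and eq: "\<And>a. (CLINT \<omega>|M. cis (\<Sum>i\<in>J. a i * X i \<omega>)) = (CLINT \<omega>|N. cis (\<Sum>i\<in>J. a i * X' i \<omega>))"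
  shows "distr M (\<Pi>\<^sub>M i\<in>J. borel) (\<lambda>\<omega>. \<lambda>i\<in>J. X i \<omega>) = distr N (\<Pi>\<^sub>M i\<in>J. borel) (\<lambda>\<omega>. \<lambda>i\<in>J. X' i \<omega>)"
    (is "?P = ?Q")
proof -
  interpret M: prob_space M by fact
  interpret N: prob_space N by fact
  have PP: "prob_space ?P" "prob_space ?Q"
    by (intro M.prob_space_distr N.prob_space_distr; measurable)+
  interpret P: prob_space ?P by fact
  have rect: "emeasure ?P (Pi\<^sub>E J A) = emeasure ?Q (Pi\<^sub>E J A)" if A: "\<And>i. i \<in> J \<Longrightarrow> A i \<in> sets borel" for A
  proof -
    have [measurable]: "Pi\<^sub>E J A \<in> sets (\<Pi>\<^sub>M i\<in>J. borel)" using J A by (intro sets_PiM_I_finite) auto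
    have ind: "indicator (Pi\<^sub>E J A) (\<lambda>i\<in>J. x i) = (\<Prod>i\<in>J. indicator (A i) (x i) :: real)" for x :: "'i \<Rightarrow> real"
    proof (cases "\<forall>i\<in>J. x i \<in> A i")
      case True
      then have "(\<Prod>i\<in>J. indicator (A i) (x i) :: real) = 1" by (intro prod.neutral) auto
      with True show ?thesis by (auto simp: indicator_def PiE_iff)
    next
      case False
      then have "\<exists>i\<in>J. indicator (A i) (x i) = (0::real)" by (simp add: indicator_eq_0_iff)
      then have "(\<Prod>i\<in>J. indicator (A i) (x i) :: real) = 0" using J by (rule prod_zero[rotated])
      with False show ?thesis by (auto simp: indicator_def PiE_iff)
    qed
    have "complex_of_real (LINT \<omega>|M. (\<Prod>i\<in>J. indicator (A i) (X i \<omega>))) =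
         complex_of_real (LINT \<omega>|N. (\<Prod>i\<in>J. indicator (A i) (X' i \<omega>)))"
      using swap_char_for_indicators[of M N J "{}" X X' A "\<lambda>_. 0"] assms A
         M.finite_measure_axioms N.finite_measure_axioms by (simp add: scaleR_conv_of_real del: of_real_prod)
    then have "(LINT \<omega>|M. indicator (Pi\<^sub>E J A) (\<lambda>i\<in>J. X i \<omega>)) = (LINT \<omega>|N. indicator (Pi\<^sub>E J A) (\<lambda>i\<in>J. X' i \<omega>) :: real)"
      by (simp add: ind del: of_real_prod)
    then have int_eq: "(LINT x|?P. indicator (Pi\<^sub>E J A) x :: real) = (LINT x|?Q. indicator (Pi\<^sub>E J A) x)"
      by (subst (1 2) integral_distr) measurable
    from PP interpret Q: prob_space ?Q by blast
    show ?thesis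
      using int_eq by (simp add: P.emeasure_eq_measure Q.emeasure_eq_measure)
  qed
  show ?thesis
  proof (rule measure_eqI_PiM_finite[where I=J and M="\<lambda>_. borel"])
    show "emeasure ?P (Pi\<^sub>E J A) = emeasure ?Q (Pi\<^sub>E J A)" if "\<And>i. i \<in> J \<Longrightarrow> A i \<in> sets borel" for A
      using rect that by blast
    show "range (\<lambda>_::nat. space (\<Pi>\<^sub>M i\<in>J. borel::real measure)) \<subseteq> prod_algebra J (\<lambda>_. borel)"
      using J by (auto simp: space_PiM  intro!: prod_algebraI_finite)
  qed (use J in \<open>auto simp: P.emeasure_finite\<close>)
qed

section \<open>Centered Gaussian vectors and rotation invariance\<close>

text \<open>
  For a normal variable the exponential moment comes from completing the square, which turns
  \<open>exp x\<close> times the density into a multiple of a shifted density. In the degenerate case all three claims concern the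
  constant \<open>0\<close>.
\<close>

lemma centered_gaussian_transforms:
  assumes "prob_space M" and G: "gaussian_rv M Z" and Z: "integrable M Z" "(LINT \<omega>|M. Z \<omega>) = 0"
  shows "integrable M (\<lambda>\<omega>. (Z \<omega>)\<^sup>2)"
    and "(CLINT \<omega>|M. cis (Z \<omega>)) = exp (- (LINT \<omega>|M. (Z \<omega>)\<^sup>2) / 2)"
    and "(\<integral>\<^sup>+\<omega>. ennreal (exp (Z \<omega>)) \<partial>M) = ennreal (exp ((LINT \<omega>|M. (Z \<omega>)\<^sup>2) / 2))"
proof -
  interpret prob_space M by fact
  have [measurable]: "Z \<in> borel_measurable M" using G by (simp add: gaussian_rv_def)
  have "integrable M (\<lambda>\<omega>. (Z \<omega>)\<^sup>2) \<and> (CLINT \<omega>|M. cis (Z \<omega>)) = exp (- (LINT \<omega>|M. (Z \<omega>)\<^sup>2) / 2)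
    \<and> (\<integral>\<^sup>+\<omega>. ennreal (exp (Z \<omega>)) \<partial>M) = ennreal (exp ((LINT \<omega>|M. (Z \<omega>)\<^sup>2) / 2))"
    using G unfolding gaussian_rv_def
  proof (elim conjE disjE exE)
    fix \<mu> \<sigma> :: real assume \<sigma>: "\<sigma> > 0" and D: "distributed M lborel Z (\<lambda>x. ennreal (normal_density \<mu> \<sigma> x))"
    have \<mu>: "\<mu> = 0" using normal_distributed_expectation[OF \<sigma> D] Z by simp
    have var: "(LINT \<omega>|M. (Z \<omega>)\<^sup>2) = \<sigma>\<^sup>2"
      using normal_distributed_variance[OF \<sigma> D] Z by simp
    have int: "integrable M (\<lambda>\<omega>. (Z \<omega>)\<^sup>2)"
      using distributed_integrable[OF D, of "\<lambda>x. x\<^sup>2"] integrable_normal_moment[OF \<sigma>, of \<mu> 2] \<mu> by simp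
    have W: "distributed M lborel (\<lambda>\<omega>. Z \<omega> / \<sigma>) (\<lambda>x. ennreal (std_normal_density x))"
      using normal_standard_normal_convert[OF \<sigma>, of Z \<mu>] D \<mu> by simp
    have "(CLINT \<omega>|M. cis (Z \<omega>)) = (CLINT \<omega>|M. iexp (\<sigma> * (Z \<omega> / \<sigma>)))"
      using \<sigma> by (simp add: cis_conv_exp)
    also have "\<dots> = (CLINT x|distr M lborel (\<lambda>\<omega>. Z \<omega> / \<sigma>). iexp (\<sigma> * x))"
      by (subst integral_distr) auto
    also have "\<dots> = char std_normal_distribution \<sigma>"
      unfolding char_def using W by (simp add: distributed_def)
    also have "\<dots> = exp (- (LINT \<omega>|M. (Z \<omega>)\<^sup>2) / 2)"
      by (simp add: char_std_normal_distribution var)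
    finally have char: "(CLINT \<omega>|M. cis (Z \<omega>)) = exp (- (LINT \<omega>|M. (Z \<omega>)\<^sup>2) / 2)" .
    have shift: "normal_density 0 \<sigma> x * exp x = exp (\<sigma>\<^sup>2 / 2) * normal_density (\<sigma>\<^sup>2) \<sigma> x" for x
    proof -
      have "- x\<^sup>2 / (2 * \<sigma>\<^sup>2) + x = \<sigma>\<^sup>2 / 2 + - (x - \<sigma>\<^sup>2)\<^sup>2 / (2 * \<sigma>\<^sup>2)"
        using \<sigma> by (simp add: field_simps power2_eq_square)
      then have "exp (- x\<^sup>2 / (2 * \<sigma>\<^sup>2)) * exp x = exp (\<sigma>\<^sup>2 / 2) * exp (- (x - \<sigma>\<^sup>2)\<^sup>2 / (2 * \<sigma>\<^sup>2))"
        by (simp only: exp_add[symmetric])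
      then show ?thesis by (simp add: normal_density_def)
    qed
    have "(\<integral>\<^sup>+\<omega>. ennreal (exp (Z \<omega>)) \<partial>M) = (\<integral>\<^sup>+x. ennreal (normal_density \<mu> \<sigma> x) * ennreal (exp x) \<partial>lborel)"
      by (rule distributed_nn_integral[OF D, symmetric]) simp
    also have "\<dots> = (\<integral>\<^sup>+x. ennreal (exp (\<sigma>\<^sup>2 / 2)) * ennreal (normal_density (\<sigma>\<^sup>2) \<sigma> x) \<partial>lborel)"
      by (simp add: \<mu> ennreal_mult'[symmetric] shift)
    also have "\<dots> = ennreal (exp (\<sigma>\<^sup>2 / 2)) * (\<integral>\<^sup>+x. ennreal (normal_density (\<sigma>\<^sup>2) \<sigma> x) \<partial>lborel)"
      by (rule nn_integral_cmult) simp
    also have "(\<integral>\<^sup>+x. ennreal (normal_density (\<sigma>\<^sup>2) \<sigma> x) \<partial>lborel) = 1"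
      using \<sigma> by (subst nn_integral_eq_integral) auto
    finally show ?thesis using int char var by simp
  next
    fix \<mu> :: real assume "AE \<omega> in M. Z \<omega> = \<mu>"
    moreover from this have "(LINT \<omega>|M. Z \<omega>) = (LINT \<omega>|M. \<mu>)" by (intro integral_cong_AE) auto
    ultimately have Z0: "AE \<omega> in M. Z \<omega> = 0" using Z by (simp add: prob_space)
    then have sq: "AE \<omega> in M. (Z \<omega>)\<^sup>2 = 0" by auto
    have "integrable M (\<lambda>\<omega>. (Z \<omega>)\<^sup>2) = integrable M (\<lambda>\<omega>. 0 :: real)"
      by (rule integrable_cong_AE) (use sq in auto)
    moreover have "(LINT \<omega>|M. (Z \<omega>)\<^sup>2) = (LINT \<omega>|M. 0)"
      by (rule integral_cong_AE) (use sq in auto)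
    moreover have "(CLINT \<omega>|M. cis (Z \<omega>)) = (CLINT \<omega>|M. 1)"
      by (rule integral_cong_AE) (use Z0 in \<open>auto simp: cis_conv_exp\<close>)
    moreover have "(\<integral>\<^sup>+\<omega>. ennreal (exp (Z \<omega>)) \<partial>M) = (\<integral>\<^sup>+\<omega>. 1 \<partial>M)"
      by (rule nn_integral_cong_AE) (use Z0 in auto)
    ultimately show ?thesis by (simp add: prob_space emeasure_space_1)
  qed
  then show "integrable M (\<lambda>\<omega>. (Z \<omega>)\<^sup>2)"
    and "(CLINT \<omega>|M. cis (Z \<omega>)) = exp (- (LINT \<omega>|M. (Z \<omega>)\<^sup>2) / 2)"
    and "(\<integral>\<^sup>+\<omega>. ennreal (exp (Z \<omega>)) \<partial>M) = ennreal (exp ((LINT \<omega>|M. (Z \<omega>)\<^sup>2) / 2))" by auto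
qed

locale centered_gaussian_vector = prob_space M for M :: "'a measure" +
  fixes X :: "'i \<Rightarrow> 'a \<Rightarrow> real" and J :: "'i set"
  assumes gaussian: "gaussian_family M X" and centered: "centered M X" and finite_index: "finite J"
begin

definition variance_of :: "('i \<Rightarrow> real) \<Rightarrow> real" where
  "variance_of a = (LINT \<omega>|M. (\<Sum>i\<in>J. a i * X i \<omega>)\<^sup>2)"

lemma measurable_X[measurable]: "X i \<in> borel_measurable M"
  using centered by (auto simp: centered_def)

lemma combination_transforms:
  shows "integrable M (\<lambda>\<omega>. (\<Sum>i\<in>J. a i * X i \<omega>)\<^sup>2)"
    and "(CLINT \<omega>|M. cis (\<Sum>i\<in>J. a i * X i \<omega>)) = exp (- variance_of a / 2)"
    and "(\<integral>\<^sup>+\<omega>. ennreal (exp (\<Sum>i\<in>J. a i * X i \<omega>)) \<partial>M) = ennreal (exp (variance_of a / 2))"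
proof -
  have "gaussian_rv M (\<lambda>\<omega>. \<Sum>i\<in>J. a i * X i \<omega>)"
    using gaussian finite_index by (simp add: gaussian_family_def)
  moreover have "integrable M (\<lambda>\<omega>. \<Sum>i\<in>J. a i * X i \<omega>)" "(LINT \<omega>|M. (\<Sum>i\<in>J. a i * X i \<omega>)) = 0"
    using centered by (auto simp: centered_def)
  ultimately show "integrable M (\<lambda>\<omega>. (\<Sum>i\<in>J. a i * X i \<omega>)\<^sup>2)"
    and "(CLINT \<omega>|M. cis (\<Sum>i\<in>J. a i * X i \<omega>)) = exp (- variance_of a / 2)"
    and "(\<integral>\<^sup>+\<omega>. ennreal (exp (\<Sum>i\<in>J. a i * X i \<omega>)) \<partial>M) = ennreal (exp (variance_of a / 2))"
    using centered_gaussian_transforms[OF prob_space_axioms] unfolding variance_of_def by auto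
qed

lemma pair_char:
  "(CLINT \<omega>|M \<Otimes>\<^sub>M M. cis ((\<Sum>i\<in>J. a i * X i (fst \<omega>)) + (\<Sum>i\<in>J. b i * X i (snd \<omega>))))
     = exp (- (variance_of a + variance_of b) / 2)"
proof -
  interpret P: pair_prob_space M M ..
  have int: "integrable (M \<Otimes>\<^sub>M M) (\<lambda>\<omega>. cis ((\<Sum>i\<in>J. a i * X i (fst \<omega>)) + (\<Sum>i\<in>J. b i * X i (snd \<omega>))))"
    by (rule P.integrable_const_bound[where B=1]) (auto simp: cis_conv_exp)
  have "(CLINT \<omega>|M \<Otimes>\<^sub>M M. cis ((\<Sum>i\<in>J. a i * X i (fst \<omega>)) + (\<Sum>i\<in>J. b i * X i (snd \<omega>))))
    = (CLINT x|M. CLINT y|M. cis (\<Sum>i\<in>J. a i * X i x) * cis (\<Sum>i\<in>J. b i * X i y))"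
    using P.integral_fst'[OF int] by (simp add: cis_mult)
  also have "\<dots> = exp (- variance_of a / 2) * exp (- variance_of b / 2)"
    by (simp add: combination_transforms)
  also have "\<dots> = exp (- (variance_of a + variance_of b) / 2)"
    by (simp add: exp_add[symmetric] add_divide_distrib[symmetric] flip: of_real_mult)
  finally show ?thesis .
qed

lemma variance_rotate:
  assumes "c\<^sup>2 + s\<^sup>2 = 1"
  shows "variance_of (\<lambda>i. c * a i - s * b i) + variance_of (\<lambda>i. s * a i + c * b i) = variance_of a + variance_of b"
proof -
  let ?A = "\<lambda>\<omega>. \<Sum>i\<in>J. a i * X i \<omega>" and ?B = "\<lambda>\<omega>. \<Sum>i\<in>J. b i * X i \<omega>"
  have 1: "(\<Sum>i\<in>J. (c * a i - s * b i) * X i \<omega>) = c * ?A \<omega> - s * ?B \<omega>"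
     and 2: "(\<Sum>i\<in>J. (s * a i + c * b i) * X i \<omega>) = s * ?A \<omega> + c * ?B \<omega>" for \<omega>
    by (simp_all add: algebra_simps sum_subtractf sum.distrib sum_distrib_left)
  have "variance_of (\<lambda>i. c * a i - s * b i) + variance_of (\<lambda>i. s * a i + c * b i)
     = (LINT \<omega>|M. (c * ?A \<omega> - s * ?B \<omega>)\<^sup>2 + (s * ?A \<omega> + c * ?B \<omega>)\<^sup>2)"
    using combination_transforms(1)[of "\<lambda>i. c * a i - s * b i"] combination_transforms(1)[of "\<lambda>i. s * a i + c * b i"]
    unfolding variance_of_def 1 2 by simp
  also have "\<dots> = (LINT \<omega>|M. (?A \<omega>)\<^sup>2 + (?B \<omega>)\<^sup>2)"
  proof (rule Bochner_Integration.integral_cong[OF refl])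
    fix \<omega>
    have "(c * x - s * y)\<^sup>2 + (s * x + c * y)\<^sup>2 = (c\<^sup>2 + s\<^sup>2) * (x\<^sup>2 + y\<^sup>2)" for x y
      by (simp add: power2_eq_square algebra_simps)
    then show "(c * ?A \<omega> - s * ?B \<omega>)\<^sup>2 + (s * ?A \<omega> + c * ?B \<omega>)\<^sup>2 = (?A \<omega>)\<^sup>2 + (?B \<omega>)\<^sup>2"
      using assms by simp
  qed
  also have "\<dots> = variance_of a + variance_of b"
    using combination_transforms(1) unfolding variance_of_def by simp
  finally show ?thesis .
qed

text \<open>
  The rotation by \<open>\<theta>\<close> of the pair of independent copies \<open>(X, X')\<close> that lives on the product space, as a single family
  indexed by a disjoint sum: the left half is \<open>cos \<theta> * X + sin \<theta> * X'\<close>, the right half its derivative in \<open>\<theta>\<close>.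
\<close>

definition rotated :: "real \<Rightarrow> 'i + 'i \<Rightarrow> 'a \<times> 'a \<Rightarrow> real" where
  "rotated \<theta> k \<omega> = (case k of
       Inl i \<Rightarrow> cos \<theta> * X i (fst \<omega>) + sin \<theta> * X i (snd \<omega>)
     | Inr i \<Rightarrow> - sin \<theta> * X i (fst \<omega>) + cos \<theta> * X i (snd \<omega>))"

lemma measurable_rotated[measurable]: "rotated \<theta> k \<in> borel_measurable (M \<Otimes>\<^sub>M M)"
  unfolding rotated_def[abs_def] by (cases k) simp_all

text \<open>
  The value does not depend on \<open>\<theta>\<close>; this is the rotation invariance at the level of characteristic functions.
\<close>

lemma rotated_char:
  "(CLINT \<omega>|M \<Otimes>\<^sub>M M. cis (\<Sum>k\<in>J <+> J. a k * rotated \<theta> k \<omega>))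
     = exp (- (variance_of (\<lambda>i. a (Inl i)) + variance_of (\<lambda>i. a (Inr i))) / 2)"
proof -
  have "(\<Sum>k\<in>J <+> J. a k * rotated \<theta> k \<omega>) =
     (\<Sum>i\<in>J. (cos \<theta> * a (Inl i) - sin \<theta> * a (Inr i)) * X i (fst \<omega>))
     + (\<Sum>i\<in>J. (sin \<theta> * a (Inl i) + cos \<theta> * a (Inr i)) * X i (snd \<omega>))" for \<omega>
    using finite_index by (simp add: sum.Plus rotated_def algebra_simps sum.distrib sum_subtractf)
  then show ?thesis
    using variance_rotate[of "cos \<theta>" "sin \<theta>"] by (simp add: pair_char del: minus_add_distrib)
qed

lemma rotation_invariance:
  assumes [measurable]: "f \<in> borel_measurable ((\<Pi>\<^sub>M i\<in>J. borel) \<Otimes>\<^sub>M (\<Pi>\<^sub>M i\<in>J. borel))"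
  shows "(\<integral>\<^sup>+\<omega>. f (\<lambda>i\<in>J. cos \<theta> * X i (fst \<omega>) + sin \<theta> * X i (snd \<omega>),
                     \<lambda>i\<in>J. - sin \<theta> * X i (fst \<omega>) + cos \<theta> * X i (snd \<omega>)) \<partial>(M \<Otimes>\<^sub>M M))
       = (\<integral>\<^sup>+\<omega>. f (\<lambda>i\<in>J. X i (fst \<omega>), \<lambda>i\<in>J. X i (snd \<omega>)) \<partial>(M \<Otimes>\<^sub>M M))"
proof -
  interpret P: pair_prob_space M M ..
  define g where "g z = f (\<lambda>i\<in>J. z (Inl i), \<lambda>i\<in>J. z (Inr i))" for z
  let ?R = "\<lambda>\<theta> \<omega>. \<lambda>k\<in>J <+> J. rotated \<theta> k \<omega>"
  let ?B = "\<Pi>\<^sub>M k\<in>J <+> J. (borel :: real measure)"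
  have [measurable]: "g \<in> borel_measurable ?B"
  proof -
    have "(\<lambda>z. \<lambda>i\<in>J. z (Inl i)) \<in> measurable ?B (\<Pi>\<^sub>M i\<in>J. borel)"
         "(\<lambda>z. \<lambda>i\<in>J. z (Inr i)) \<in> measurable ?B (\<Pi>\<^sub>M i\<in>J. borel)"
      by (intro measurable_restrict measurable_component_singleton; blast)+
    then show ?thesis unfolding g_def[abs_def] by measurable
  qed
  have "distr (M \<Otimes>\<^sub>M M) ?B (?R \<theta>) = distr (M \<Otimes>\<^sub>M M) ?B (?R 0)"
    using finite_index by (intro joint_char_determines_law P.prob_space_axioms) (auto simp: rotated_char)
  then have "(\<integral>\<^sup>+z. g z \<partial>distr (M \<Otimes>\<^sub>M M) ?B (?R \<theta>)) = (\<integral>\<^sup>+z. g z \<partial>distr (M \<Otimes>\<^sub>M M) ?B (?R 0))"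
    by simp
  then have "(\<integral>\<^sup>+\<omega>. g (?R \<theta> \<omega>) \<partial>(M \<Otimes>\<^sub>M M)) = (\<integral>\<^sup>+\<omega>. g (?R 0 \<omega>) \<partial>(M \<Otimes>\<^sub>M M))"
    by (simp add: nn_integral_distr)
  moreover have "g (?R \<theta> \<omega>) = f (\<lambda>i\<in>J. cos \<theta> * X i (fst \<omega>) + sin \<theta> * X i (snd \<omega>),
                     \<lambda>i\<in>J. - sin \<theta> * X i (fst \<omega>) + cos \<theta> * X i (snd \<omega>))" for \<omega> \<theta>
    unfolding g_def rotated_def by (intro arg_cong[where f=f] prod_eqI; auto simp: restrict_def fun_eq_iff)
  ultimately show ?thesis by simp
qed

end

section \<open>Gaussian concentration\<close>

text \<open>
  Jensen's inequality for the uniform distribution on \<open>[a, b]\<close>: the increment of \<open>f\<close> is the average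
  of \<open>(b - a) * h\<close>.
\<close>

lemma exp_increment_le_average:
  fixes f h :: "real \<Rightarrow> real"
  assumes deriv: "\<And>t. (f has_real_derivative h t) (at t)"
    and [measurable]: "h \<in> borel_measurable borel" and B: "\<And>t. \<bar>h t\<bar> \<le> B" and ab: "a < b"
  shows "ennreal (exp (f b - f a)) \<le> (\<integral>\<^sup>+t. ennreal (exp ((b - a) * h t)) \<partial>uniform_measure lborel {a..b})"
proof -
  let ?P = "uniform_measure lborel {a..b}"
  interpret P: prob_space ?P
    by (rule prob_space_uniform_measure) (use ab in auto)
  have density: "?P = density lborel (\<lambda>x. ennreal (indicator {a..b} x / (b - a)))"
    unfolding uniform_measure_def using ab
    by (intro density_cong) (auto simp: indicator_def divide_ennreal ennreal_1[symmetric] simp del: ennreal_1)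
  have "(h has_integral (f b - f a)) {a..b}"
    using ab deriv by (intro fundamental_theorem_of_calculus)
      (auto simp: has_real_derivative_iff_has_vector_derivative[symmetric] intro: has_field_derivative_at_within)
  moreover have "set_integrable lborel {a..b} h"
    unfolding set_integrable_def by (rule integrableI_bounded_set_indicator[where B=B]) (use B ab in auto)
  ultimately have "(LINT t:{a..b}|lborel. h t) = f b - f a"
    by (simp add: set_borel_integral_eq_integral integral_unique)
  moreover have "P.expectation (\<lambda>t. (b - a) * h t) = (LINT t:{a..b}|lborel. h t)"
    unfolding density set_lebesgue_integral_def using ab
    by (subst integral_density) (auto intro!: Bochner_Integration.integral_cong)
  ultimately have mean: "P.expectation (\<lambda>t. (b - a) * h t) = f b - f a" by simp
  have bound: "\<bar>(b - a) * h t\<bar> \<le> (b - a) * B" for t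
    using B[of t] ab by (simp add: abs_mult mult_left_mono)
  have int: "integrable ?P (\<lambda>t. (b - a) * h t)" "integrable ?P (\<lambda>t. exp ((b - a) * h t))"
    using bound by (intro P.integrable_const_bound[where B="(b - a) * B"] P.integrable_const_bound[where B="exp ((b - a) * B)"]; force simp: abs_le_iff)+
  have "exp (f b - f a) \<le> P.expectation (\<lambda>t. exp ((b - a) * h t))"
    unfolding mean[symmetric]
    by (rule P.jensens_inequality[OF int(1) _ _ int(2), of UNIV]) (auto intro: exp_convex)
  then have "ennreal (exp (f b - f a)) \<le> ennreal (P.expectation (\<lambda>t. exp ((b - a) * h t)))"
    by (rule ennreal_leI)
  also have "\<dots> = (\<integral>\<^sup>+t. ennreal (exp ((b - a) * h t)) \<partial>?P)"
    by (rule nn_integral_eq_integral[symmetric, OF int(2)]) auto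
  finally show ?thesis .
qed

text \<open>
  Differentiability of \<open>F\<close> on the coordinates in \<open>J\<close>, with gradient \<open>D\<close>. It is expressed by the chain rule along
  differentiable curves, since the function type \<open>'i \<Rightarrow> real\<close> carries no norm, and this is the form
  in which it is applied to the rotation path.
\<close>

definition has_partials :: "'i set \<Rightarrow> (('i \<Rightarrow> real) \<Rightarrow> real) \<Rightarrow> ('i \<Rightarrow> ('i \<Rightarrow> real) \<Rightarrow> real) \<Rightarrow> bool" where
  "has_partials J F D \<longleftrightarrow>
     (\<forall>x x' t. (\<forall>i\<in>J. ((\<lambda>s. x s i) has_real_derivative x' i) (at t)) \<longrightarrow>
       ((\<lambda>s. F (x s)) has_real_derivative (\<Sum>i\<in>J. D i (x t) * x' i)) (at t))"

lemma has_partials_cmult: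
  "has_partials J F D \<Longrightarrow> has_partials J (\<lambda>x. c * F x) (\<lambda>i x. c * D i x)"
  unfolding has_partials_def by (auto simp: mult.assoc sum_distrib_left[symmetric] intro!: DERIV_cmult)

context centered_gaussian_vector
begin

text \<open>
  The Maurey--Pisier estimate. After averaging over the angle and exchanging integrals, every angle contributes the
  same amount by rotation invariance, namely the exponential moment of \<open>\<pi> / 2 * \<nabla>F(X) \<bullet> X'\<close>. For fixed \<open>X\<close>
  this is a Gaussian exponential moment in \<open>X'\<close>, whose variance is at most \<open>(\<pi> / 2)\<^sup>2 * L * G\<close>.
\<close>

lemma exp_increment_expectation:
  fixes F :: "('i \<Rightarrow> real) \<Rightarrow> real" and D :: "'i \<Rightarrow> ('i \<Rightarrow> real) \<Rightarrow> real"
  assumes [measurable]: "F \<in> borel_measurable (\<Pi>\<^sub>M i\<in>J. borel)"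
       "\<And>i. i \<in> J \<Longrightarrow> D i \<in> borel_measurable (\<Pi>\<^sub>M i\<in>J. borel)"
    and chain: "has_partials J F D"
    and grad: "\<And>x. (\<Sum>i\<in>J. (D i x)\<^sup>2) \<le> G"
    and var: "\<And>a. variance_of a \<le> L * (\<Sum>i\<in>J. (a i)\<^sup>2)" and L: "L \<ge> 0"
  shows "(\<integral>\<^sup>+\<omega>. ennreal (exp (F (\<lambda>i\<in>J. X i (snd \<omega>)) - F (\<lambda>i\<in>J. X i (fst \<omega>)))) \<partial>(M \<Otimes>\<^sub>M M))
     \<le> ennreal (exp (pi\<^sup>2 * L * G / 8))"
proof -
  interpret MM: pair_prob_space M M ..
  define P where "P = uniform_measure lborel {0..pi / 2}"
  have "prob_space P"
    unfolding P_def by (rule prob_space_uniform_measure) auto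
  then interpret P: prob_space P .
  interpret MMP: pair_sigma_finite "M \<Otimes>\<^sub>M M" P ..
  have setsP[measurable_cong]: "sets P = sets borel" by (simp add: P_def)
  define u where "u \<theta> \<omega> = (\<lambda>i\<in>J. cos \<theta> * X i (fst \<omega>) + sin \<theta> * X i (snd \<omega>))" for \<theta> and \<omega> :: "'a \<times> 'a"
  define v where "v \<theta> \<omega> = (\<lambda>i\<in>J. - sin \<theta> * X i (fst \<omega>) + cos \<theta> * X i (snd \<omega>))" for \<theta> and \<omega> :: "'a \<times> 'a"
  define f where "f = (\<lambda>(x, y). ennreal (exp (pi / 2 * (\<Sum>i\<in>J. D i x * y i))))"
  have [measurable]: "f \<in> borel_measurable ((\<Pi>\<^sub>M i\<in>J. borel) \<Otimes>\<^sub>M (\<Pi>\<^sub>M i\<in>J. borel))"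
    unfolding f_def by measurable
  have G: "G \<ge> 0" using grad[of undefined] by (meson order_trans sum_nonneg zero_le_power2)
  have Dbound: "\<bar>D i x\<bar> \<le> sqrt G" if "i \<in> J" for i x
  proof -
    have "(D i x)\<^sup>2 \<le> (\<Sum>i\<in>J. (D i x)\<^sup>2)" using that finite_index by (intro member_le_sum) auto
    also have "\<dots> \<le> G" by (rule grad)
    finally show ?thesis using real_le_rsqrt[of "\<bar>D i x\<bar>" G] by simp
  qed
  have pointwise: "ennreal (exp (F (\<lambda>i\<in>J. X i (snd \<omega>)) - F (\<lambda>i\<in>J. X i (fst \<omega>)))) \<le> (\<integral>\<^sup>+\<theta>. f (u \<theta> \<omega>, v \<theta> \<omega>) \<partial>P)"
    if \<omega>: "\<omega> \<in> space (M \<Otimes>\<^sub>M M)" for \<omega>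
  proof -
    define h where "h \<theta> = (\<Sum>i\<in>J. D i (u \<theta> \<omega>) * v \<theta> \<omega> i)" for \<theta>
    define B where "B = (\<Sum>i\<in>J. sqrt G * (\<bar>X i (fst \<omega>)\<bar> + \<bar>X i (snd \<omega>)\<bar>))"
    have [measurable]: "(\<lambda>\<theta>. u \<theta> \<omega>) \<in> measurable borel (\<Pi>\<^sub>M i\<in>J. borel)" unfolding u_def by measurable
    have "((\<lambda>s. F (u s \<omega>)) has_real_derivative h \<theta>) (at \<theta>)" for \<theta>
      unfolding h_def by (rule chain[unfolded has_partials_def, rule_format]) (auto simp: u_def v_def intro!: derivative_eq_intros)
    moreover have "h \<in> borel_measurable borel" unfolding h_def[abs_def] v_def by simp
    moreover have "\<bar>h \<theta>\<bar> \<le> B" for \<theta>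
      unfolding h_def B_def
    proof (rule order_trans[OF sum_abs], rule sum_mono)
      fix i assume i: "i \<in> J"
      have "\<bar>- sin \<theta> * x + cos \<theta> * y\<bar> \<le> \<bar>x\<bar> + \<bar>y\<bar>" for x y
      proof -
        have "\<bar>- sin \<theta> * x\<bar> \<le> 1 * \<bar>x\<bar>" "\<bar>cos \<theta> * y\<bar> \<le> 1 * \<bar>y\<bar>"
          unfolding abs_mult by (intro mult_right_mono; simp)+
        then show ?thesis by linarith
      qed
      then have "\<bar>v \<theta> \<omega> i\<bar> \<le> \<bar>X i (fst \<omega>)\<bar> + \<bar>X i (snd \<omega>)\<bar>"
        using i by (simp only: v_def restrict_apply if_True)
      then show "\<bar>D i (u \<theta> \<omega>) * v \<theta> \<omega> i\<bar> \<le> sqrt G * (\<bar>X i (fst \<omega>)\<bar> + \<bar>X i (snd \<omega>)\<bar>)"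
        unfolding abs_mult by (intro mult_mono Dbound i) (auto simp: G)
    qed
    ultimately have "ennreal (exp (F (u (pi / 2) \<omega>) - F (u 0 \<omega>))) \<le> (\<integral>\<^sup>+\<theta>. ennreal (exp ((pi / 2 - 0) * h \<theta>)) \<partial>P)"
      unfolding P_def by (intro exp_increment_le_average[where B=B]) auto
    then show ?thesis by (simp add: u_def f_def h_def[symmetric] split_beta)
        (simp add: h_def u_def v_def)
  qed
  have "(\<integral>\<^sup>+\<omega>. ennreal (exp (F (\<lambda>i\<in>J. X i (snd \<omega>)) - F (\<lambda>i\<in>J. X i (fst \<omega>)))) \<partial>(M \<Otimes>\<^sub>M M))
     \<le> (\<integral>\<^sup>+\<omega>. (\<integral>\<^sup>+\<theta>. f (u \<theta> \<omega>, v \<theta> \<omega>) \<partial>P) \<partial>(M \<Otimes>\<^sub>M M))"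
    by (rule nn_integral_mono) (rule pointwise)
  also have "\<dots> = (\<integral>\<^sup>+\<theta>. (\<integral>\<^sup>+\<omega>. f (u \<theta> \<omega>, v \<theta> \<omega>) \<partial>(M \<Otimes>\<^sub>M M)) \<partial>P)"
    by (rule MMP.Fubini'[symmetric]) (simp add: u_def v_def split_beta)
  also have "\<dots> = (\<integral>\<^sup>+\<theta>. (\<integral>\<^sup>+\<omega>. f (\<lambda>i\<in>J. X i (fst \<omega>), \<lambda>i\<in>J. X i (snd \<omega>)) \<partial>(M \<Otimes>\<^sub>M M)) \<partial>P)"
    unfolding u_def v_def by (intro nn_integral_cong rotation_invariance) simp
  also have "\<dots> = (\<integral>\<^sup>+\<omega>. f (\<lambda>i\<in>J. X i (fst \<omega>), \<lambda>i\<in>J. X i (snd \<omega>)) \<partial>(M \<Otimes>\<^sub>M M))"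
    by (simp add: P.emeasure_space_1)
  also have "\<dots> = (\<integral>\<^sup>+x. (\<integral>\<^sup>+y. f (\<lambda>i\<in>J. X i x, \<lambda>i\<in>J. X i y) \<partial>M) \<partial>M)"
    by (subst nn_integral_fst[symmetric]) auto
  also have "\<dots> \<le> (\<integral>\<^sup>+x. ennreal (exp (pi\<^sup>2 * L * G / 8)) \<partial>M)"
  proof (rule nn_integral_mono)
    fix x
    define a where "a i = pi / 2 * D i (\<lambda>i\<in>J. X i x)" for i
    have "f (\<lambda>i\<in>J. X i x, \<lambda>i\<in>J. X i y) = ennreal (exp (\<Sum>i\<in>J. a i * X i y))" for y
      by (simp add: f_def a_def sum_distrib_left mult.assoc)
    then have "(\<integral>\<^sup>+y. f (\<lambda>i\<in>J. X i x, \<lambda>i\<in>J. X i y) \<partial>M) = ennreal (exp (variance_of a / 2))"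
      by (simp add: combination_transforms)
    also have "variance_of a \<le> L * ((pi / 2)\<^sup>2 * (\<Sum>i\<in>J. (D i (\<lambda>i\<in>J. X i x))\<^sup>2))"
      using var[of a] by (simp only: a_def power_mult_distrib sum_distrib_left)
    also have "\<dots> \<le> L * ((pi / 2)\<^sup>2 * G)"
      using L grad by (intro mult_left_mono) auto
    finally show "(\<integral>\<^sup>+y. f (\<lambda>i\<in>J. X i x, \<lambda>i\<in>J. X i y) \<partial>M) \<le> ennreal (exp (pi\<^sup>2 * L * G / 8))"
      by (auto simp: power2_eq_square field_simps)
  qed
  also have "\<dots> = ennreal (exp (pi\<^sup>2 * L * G / 8))"
    by (simp add: emeasure_space_1)
  finally show ?thesis .
qed

text \<open>
  Jensen's inequality in the independent copy replaces \<open>F(X')\<close> by its mean, so the previous estimate,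
  applied to \<open>s * F\<close>, bounds the Laplace transform of \<open>F - E F\<close>. The Chernoff bound with the optimal \<open>s\<close> concludes.
\<close>

lemma gaussian_upper_tail:
  fixes F :: "('i \<Rightarrow> real) \<Rightarrow> real" and D :: "'i \<Rightarrow> ('i \<Rightarrow> real) \<Rightarrow> real"
  assumes [measurable]: "F \<in> borel_measurable (\<Pi>\<^sub>M i\<in>J. borel)"
       "\<And>i. i \<in> J \<Longrightarrow> D i \<in> borel_measurable (\<Pi>\<^sub>M i\<in>J. borel)"
    and bounded: "\<And>x. \<bar>F x\<bar> \<le> B"
    and partials: "has_partials J F D" and grad: "\<And>x. (\<Sum>i\<in>J. (D i x)\<^sup>2) \<le> G"
    and var: "\<And>a. variance_of a \<le> L * (\<Sum>i\<in>J. (a i)\<^sup>2)"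
    and pos: "L > 0" "G > 0" "r \<ge> 0"
  shows "prob {\<omega> \<in> space M. F (\<lambda>i\<in>J. X i \<omega>) - expectation (\<lambda>\<omega>. F (\<lambda>i\<in>J. X i \<omega>)) \<ge> r}
     \<le> exp (- (2 * r\<^sup>2) / (pi\<^sup>2 * L * G))"
proof (cases "r = 0")
  case True
  then show ?thesis by simp
next
  case False
  define Y where "Y \<omega> = F (\<lambda>i\<in>J. X i \<omega>)" for \<omega>
  have [measurable]: "Y \<in> borel_measurable M" unfolding Y_def[abs_def] by measurable
  \<comment> \<open>the minimiser of \<open>\<pi>\<^sup>2 * L * G * s\<^sup>2 / 8 - s * r\<close>\<close>
  define s where "s = 4 * r / (pi\<^sup>2 * L * G)"
  have s: "s > 0" using pos False by (simp add: s_def)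
  have bound: "\<bar>t * Y \<omega>\<bar> \<le> \<bar>t\<bar> * B" for t \<omega>
    using bounded by (simp add: Y_def abs_mult mult_left_mono)
  have int: "integrable M (\<lambda>\<omega>. t * Y \<omega>)" "integrable M (\<lambda>\<omega>. exp (t * Y \<omega>))" for t
    using bound[of t]
    by (intro integrable_const_bound[where B="\<bar>t\<bar> * B"] integrable_const_bound[where B="exp (\<bar>t\<bar> * B)"]; force simp: abs_le_iff)+
  define A where "A t = expectation (\<lambda>\<omega>. exp (t * Y \<omega>))" for t
  have A: "(\<integral>\<^sup>+\<omega>. ennreal (exp (t * Y \<omega>)) \<partial>M) = ennreal (A t)" "A t \<ge> 0" for t
    unfolding A_def by (rule nn_integral_eq_integral[OF int(2)]) auto
  have "ennreal (A s * A (- s)) = (\<integral>\<^sup>+x. (\<integral>\<^sup>+y. ennreal (exp (s * Y y)) * ennreal (exp (- s * Y x)) \<partial>M) \<partial>M)"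
    using A(1)[of s] A(1)[of "- s"] A(2)[of s]
    by (subst nn_integral_multc) (simp_all add: nn_integral_cmult ennreal_mult')
  also have "\<dots> = (\<integral>\<^sup>+x. (\<integral>\<^sup>+y. ennreal (exp (s * Y y - s * Y x)) \<partial>M) \<partial>M)"
    by (simp add: ennreal_mult'[symmetric] exp_add[symmetric])
  also have "\<dots> = (\<integral>\<^sup>+\<omega>. ennreal (exp (s * Y (snd \<omega>) - s * Y (fst \<omega>))) \<partial>(M \<Otimes>\<^sub>M M))"
    by (subst nn_integral_fst[symmetric]) auto
  also have "\<dots> \<le> ennreal (exp (pi\<^sup>2 * L * (s\<^sup>2 * G) / 8))"
    unfolding Y_def
  proof (rule exp_increment_expectation[where D="\<lambda>i x. s * D i x"])
    show "(\<Sum>i\<in>J. (s * D i x)\<^sup>2) \<le> s\<^sup>2 * G" for x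
      using grad[of x] by (simp add: power_mult_distrib sum_distrib_left[symmetric] mult_left_mono)
  qed (use var pos in \<open>auto intro: has_partials_cmult partials\<close>)
  finally have "A s * A (- s) \<le> exp (pi\<^sup>2 * L * (s\<^sup>2 * G) / 8)" by simp
  moreover have "exp (- s * expectation Y) \<le> A (- s)"
    using jensens_inequality[OF int(1)[of "- s"] _ _ int(2)[of "- s"], of UNIV] exp_convex
    by (simp add: A_def)
  then have "A s * exp (- s * expectation Y) \<le> A s * A (- s)" using A by (intro mult_left_mono)
  ultimately have mgf: "A s * exp (- s * expectation Y) \<le> exp (pi\<^sup>2 * L * (s\<^sup>2 * G) / 8)" by simp
  have shift: "exp (s * (Y \<omega> - expectation Y)) = exp (s * Y \<omega>) * exp (- s * expectation Y)" for \<omega>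
    by (simp add: exp_add[symmetric] algebra_simps)
  have int_shift: "integrable M (\<lambda>\<omega>. exp (s * (Y \<omega> - expectation Y)))"
    unfolding shift using int by simp
  have "prob {\<omega> \<in> space M. Y \<omega> - expectation Y \<ge> r}
     \<le> exp (- s * r) * (LINT \<omega>:space M|M. exp (s * (Y \<omega> - expectation Y)))"
    by (rule Chernoff_ineq_ge[OF s]) (auto simp only: set_integrable_def intro!: integrable_mult_indicator int_shift sets.top)
  also have "(LINT \<omega>:space M|M. exp (s * (Y \<omega> - expectation Y))) = A s * exp (- s * expectation Y)"
    using int_shift by (simp add: set_integral_space shift A_def)
  also have "exp (- s * r) * \<dots> \<le> exp (- s * r) * exp (pi\<^sup>2 * L * (s\<^sup>2 * G) / 8)"
    by (intro mult_left_mono mgf) auto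
  also have "\<dots> = exp (- (2 * r\<^sup>2) / (pi\<^sup>2 * L * G))"
    unfolding exp_add[symmetric] s_def using pos by (simp add: field_simps power2_eq_square)
  finally show ?thesis by (simp add: Y_def)
qed

theorem gaussian_concentration:
  fixes F :: "('i \<Rightarrow> real) \<Rightarrow> real" and D :: "'i \<Rightarrow> ('i \<Rightarrow> real) \<Rightarrow> real"
  assumes [measurable]: "F \<in> borel_measurable (\<Pi>\<^sub>M i\<in>J. borel)"
       "\<And>i. i \<in> J \<Longrightarrow> D i \<in> borel_measurable (\<Pi>\<^sub>M i\<in>J. borel)"
    and bounded: "\<And>x. \<bar>F x\<bar> \<le> B"
    and partials: "has_partials J F D" and grad: "\<And>x. (\<Sum>i\<in>J. (D i x)\<^sup>2) \<le> G"
    and var: "\<And>a. variance_of a \<le> L * (\<Sum>i\<in>J. (a i)\<^sup>2)"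
    and pos: "L > 0" "G > 0" "r \<ge> 0"
  shows "prob {\<omega> \<in> space M. \<bar>F (\<lambda>i\<in>J. X i \<omega>) - expectation (\<lambda>\<omega>. F (\<lambda>i\<in>J. X i \<omega>))\<bar> \<ge> r}
     \<le> 2 * exp (- (2 * r\<^sup>2) / (pi\<^sup>2 * L * G))"
proof -
  let ?Y = "\<lambda>\<omega>. F (\<lambda>i\<in>J. X i \<omega>)"
  let ?U = "{\<omega> \<in> space M. ?Y \<omega> - expectation ?Y \<ge> r}"
  let ?V = "{\<omega> \<in> space M. - ?Y \<omega> - expectation (\<lambda>\<omega>. - ?Y \<omega>) \<ge> r}"
  have "prob {\<omega> \<in> space M. \<bar>?Y \<omega> - expectation ?Y\<bar> \<ge> r} \<le> prob (?U \<union> ?V)"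
    by (rule finite_measure_mono) auto
  also have "\<dots> \<le> prob ?U + prob ?V" by (rule measure_Un_le) auto
  also have "prob ?U \<le> exp (- (2 * r\<^sup>2) / (pi\<^sup>2 * L * G))"
    by (rule gaussian_upper_tail) (use assms in auto)
  also have "prob ?V \<le> exp (- (2 * r\<^sup>2) / (pi\<^sup>2 * L * G))"
    using gaussian_upper_tail[of "\<lambda>x. - F x" "\<lambda>i x. - D i x" B G L r] assms has_partials_cmult[OF partials, of "-1"]
    by simp
  finally show ?thesis by simp
qed

end

section \<open>The spectral bound on variances\<close>

lemma cos_orthogonality:
  "has_bochner_integral lborel (\<lambda>x. cos (x * of_int m) * indicator {-pi..pi} x) (if m = 0 then 2 * pi else 0)"
proof (cases "m = 0")
  case True
  have "has_bochner_integral lborel (\<lambda>x. 1 * indicator {-pi..pi} x) (pi - (- pi))"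
    by (rule has_bochner_integral_FTC_Icc_real) (auto intro!: derivative_eq_intros)
  with True show ?thesis by simp
next
  case False
  have "has_bochner_integral lborel (\<lambda>x. cos (x * of_int m) * indicator {-pi..pi} x)
     (sin (pi * of_int m) / of_int m - sin (- pi * of_int m) / of_int m)"
    using False by (intro has_bochner_integral_FTC_Icc_real) (auto intro!: derivative_eq_intros)
  with False show ?thesis by simp
qed

text \<open>
  The right-hand side is \<open>\<bar>\<Sum>j. a j * e\<^sup>i\<^sup>j\<^sup>x\<bar>\<^sup>2\<close>; its nonnegativity is what allows the spectral density to
  be replaced by its upper bound.
\<close>

lemma trig_quadratic_form:
  fixes a :: "int \<Rightarrow> real"
  shows "(\<Sum>j\<in>J. \<Sum>k\<in>J. a j * a k * cos (x * of_int (k - j)))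
     = (\<Sum>j\<in>J. a j * cos (x * of_int j))\<^sup>2 + (\<Sum>j\<in>J. a j * sin (x * of_int j))\<^sup>2"
  by (simp add: power2_eq_square sum_product sum.distrib[symmetric] right_diff_distrib cos_diff)
     (intro sum.cong refl; simp add: algebra_simps)

text \<open>
  The variance is the integral of the trigonometric form above against \<open>p\<close>. It only grows when \<open>p\<close> is replaced by the
  constant \<open>S\<close>, and for a constant density orthogonality leaves the diagonal terms.
\<close>

lemma variance_le_spectral_density:
  fixes Y :: "int \<Rightarrow> 'a \<Rightarrow> real" and a :: "int \<Rightarrow> real"
  assumes "centered_gaussian_vector M Y J"
    and spec: "spectral_measure M Y \<rho>"
    and cont: "continuous_on {-pi..pi} p"
    and p: "\<And>x. x \<in> {-pi..pi} \<Longrightarrow> 0 \<le> p x" "\<And>x. x \<in> {-pi..pi} \<Longrightarrow> p x \<le> S"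
    and \<rho>: "\<rho> = density lborel (\<lambda>x. ennreal (p x * indicator {-pi..pi} x))"
  shows "(LINT \<omega>|M. (\<Sum>j\<in>J. a j * Y j \<omega>)\<^sup>2) \<le> 2 * pi * S * (\<Sum>j\<in>J. (a j)\<^sup>2)"
proof -
  interpret centered_gaussian_vector M Y J by fact
  note fin = finite_index
  define I :: "real set" where "I = {-pi..pi}"
  define q where "q x = p x * indicator I x" for x
  have q_meas[measurable]: "q \<in> borel_measurable borel"
    using borel_measurable_continuous_on_indicator[OF _ cont] by (simp add: q_def[abs_def] I_def mult.commute)
  have [measurable]: "I \<in> sets borel" by (simp add: I_def)
  have q: "0 \<le> q x" "q x \<le> S * indicator I x" for x using p by (auto simp: q_def I_def indicator_def)
  have S: "S \<ge> 0" using p[of 0] by (auto intro: order_trans)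
  have rho: "\<rho> = density lborel (\<lambda>x. ennreal (q x))" by (simp add: \<rho> q_def I_def)
  have cov: "(LINT \<omega>|M. Y j \<omega> * Y k \<omega>) = (LINT x|lborel. q x * cos (x * of_int (k - j)))" for j k
  proof -
    interpret R: finite_measure \<rho> using spec by (simp add: spectral_measure_def)
    have [measurable_cong]: "sets \<rho> = sets borel" using spec by (simp add: spectral_measure_def)
    let ?e = "\<lambda>x. indicator I x *\<^sub>R exp (- (\<i> * complex_of_real x * of_int (k - j)))"
    have Re: "Re (?e x) = indicator I x * cos (x * of_int (k - j))" for x
      by (simp add: Re_exp)
    have int: "integrable \<rho> ?e"
      by (rule R.integrable_const_bound[where B=1]) (auto simp: indicator_def)
    have "complex_of_real (LINT \<omega>|M. Y j \<omega> * Y (j + (k - j)) \<omega>) = (CLINT x|\<rho>. ?e x)"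
      using spec unfolding spectral_measure_def set_lebesgue_integral_def I_def by blast
    then have "(LINT \<omega>|M. Y j \<omega> * Y k \<omega>) = Re (CLINT x|\<rho>. ?e x)"
      by (metis Re_complex_of_real add_diff_cancel_left' add.commute diff_add_cancel)
    also have "\<dots> = (LINT x|\<rho>. indicator I x * cos (x * of_int (k - j)))"
      using integral_Re[OF int] by (simp only: Re)
    also have "\<dots> = (LINT x|lborel. q x * (indicator I x * cos (x * of_int (k - j))))"
      unfolding rho using q by (subst integral_density) auto
    also have "\<dots> = (LINT x|lborel. q x * cos (x * of_int (k - j)))"
      by (intro Bochner_Integration.integral_cong) (auto simp: q_def split: split_indicator)
    finally show ?thesis .
  qed
  have intI: "integrable lborel (\<lambda>x. indicator I x *\<^sub>R f x)"
    if "f \<in> borel_measurable borel" "\<And>x. \<bar>f x\<bar> \<le> B" for f :: "real \<Rightarrow> real" and B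
    using that by (intro integrableI_bounded_set_indicator[where B=B]) (auto simp: I_def)
  have intq: "integrable lborel (\<lambda>x. q x * cos (x * of_int m))" for m
  proof -
    have "integrable lborel (\<lambda>x. indicator I x *\<^sub>R (q x * cos (x * of_int m)))"
    proof (rule intI)
      fix x
      have "\<bar>q x\<bar> * \<bar>cos (x * of_int m)\<bar> \<le> S * 1"
        using q[of x] S by (intro mult_mono) (auto split: split_indicator_asm)
      then show "\<bar>q x * cos (x * of_int m)\<bar> \<le> S" by (simp add: abs_mult)
    qed simp
    moreover have "indicator I x *\<^sub>R (q x * cos (x * of_int m)) = q x * cos (x * of_int m)" for x
      by (simp add: q_def indicator_def)
    ultimately show ?thesis by (simp only:)
  qed
  have sq: "integrable M (\<lambda>\<omega>. (Y j \<omega>)\<^sup>2)" for j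
  proof -
    interpret C: centered_gaussian_vector M Y "{j}"
      using gaussian centered by unfold_locales auto
    show ?thesis using C.combination_transforms(1)[of "\<lambda>_. 1"] by simp
  qed
  have intY: "integrable M (\<lambda>\<omega>. Y j \<omega> * Y k \<omega>)" for j k
  proof (rule Bochner_Integration.integrable_bound)
    show "integrable M (\<lambda>\<omega>. (Y j \<omega>)\<^sup>2 + (Y k \<omega>)\<^sup>2)" using sq by simp
    have "\<bar>u * v\<bar> \<le> u\<^sup>2 + v\<^sup>2" for u v :: real
      using sum_squares_bound[of "\<bar>u\<bar>" "\<bar>v\<bar>"] mult_nonneg_nonneg[of "\<bar>u\<bar>" "\<bar>v\<bar>"]
      unfolding abs_mult power2_abs by linarith
    then show "AE \<omega> in M. norm (Y j \<omega> * Y k \<omega>) \<le> norm ((Y j \<omega>)\<^sup>2 + (Y k \<omega>)\<^sup>2)"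
      by simp
  qed simp
  let ?T = "\<lambda>x. (\<Sum>j\<in>J. a j * cos (x * of_int j))\<^sup>2 + (\<Sum>j\<in>J. a j * sin (x * of_int j))\<^sup>2"
  have "(LINT \<omega>|M. (\<Sum>j\<in>J. a j * Y j \<omega>)\<^sup>2) = (LINT \<omega>|M. (\<Sum>j\<in>J. \<Sum>k\<in>J. a j * a k * (Y j \<omega> * Y k \<omega>)))"
    by (simp add: power2_eq_square sum_product mult_ac)
  also have "\<dots> = (\<Sum>j\<in>J. \<Sum>k\<in>J. a j * a k * (LINT \<omega>|M. Y j \<omega> * Y k \<omega>))"
    by (simp add: intY)
  also have "\<dots> = (\<Sum>j\<in>J. \<Sum>k\<in>J. a j * a k * (LINT x|lborel. q x * cos (x * of_int (k - j))))"
    by (simp only: cov)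
  also have "\<dots> = (LINT x|lborel. (\<Sum>j\<in>J. \<Sum>k\<in>J. a j * a k * (q x * cos (x * of_int (k - j)))))"
    by (simp add: intq del: of_int_diff)
  also have "\<dots> = (LINT x|lborel. q x * ?T x)"
    unfolding trig_quadratic_form[symmetric] by (simp add: sum_distrib_left mult_ac)
  also have "\<dots> \<le> (LINT x|lborel. S * indicator I x * ?T x)"
  proof (rule integral_mono)
    show "integrable lborel (\<lambda>x. q x * ?T x)"
    proof -
      have "integrable lborel (\<lambda>x. \<Sum>j\<in>J. \<Sum>k\<in>J. a j * a k * (q x * cos (x * of_int (k - j))))"
        by (intro Bochner_Integration.integrable_sum integrable_mult_right intq)
      then show ?thesis unfolding trig_quadratic_form[symmetric] by (simp add: sum_distrib_left mult_ac)
    qed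
    show "integrable lborel (\<lambda>x. S * indicator I x * ?T x)"
    proof -
      have "integrable lborel (\<lambda>x. \<Sum>j\<in>J. \<Sum>k\<in>J. S * a j * a k * (cos (x * of_int (k - j)) * indicator I x))"
        by (intro Bochner_Integration.integrable_sum integrable_mult_right)
           (use cos_orthogonality in \<open>auto simp: I_def has_bochner_integral_iff simp del: of_int_diff\<close>)
      then show ?thesis unfolding trig_quadratic_form[symmetric] by (simp add: sum_distrib_left mult_ac)
    qed
    show "q x * ?T x \<le> S * indicator I x * ?T x" for x
      by (intro mult_right_mono q) auto
  qed
  also have "\<dots> = (LINT x|lborel. (\<Sum>j\<in>J. \<Sum>k\<in>J. S * a j * a k * (cos (x * of_int (k - j)) * indicator I x)))"
    unfolding trig_quadratic_form[symmetric] by (simp add: sum_distrib_left mult_ac)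
  also have "\<dots> = (\<Sum>j\<in>J. \<Sum>k\<in>J. S * a j * a k * (if k - j = 0 then 2 * pi else 0))"
    using cos_orthogonality by (simp add: I_def has_bochner_integral_iff del: of_int_diff)
  also have "\<dots> = (\<Sum>j\<in>J. \<Sum>k\<in>J. if j = k then 2 * pi * S * (a j)\<^sup>2 else 0)"
    by (intro sum.cong refl) (auto simp: power2_eq_square)
  also have "\<dots> = 2 * pi * S * (\<Sum>j\<in>J. (a j)\<^sup>2)"
    using fin by (simp add: sum_distrib_left)
  finally show ?thesis .
qed

section \<open>Smoothing the sign function\<close>

text \<open>
  A smooth sign function whose derivative is at most \<open>1 / d\<close> and whose defect from the true sign, for \<open>x \<noteq> 0\<close>, is at most
  \<open>1 - (soft_sign d x)\<^sup>2 = d\<^sup>2 / (x\<^sup>2 + d\<^sup>2)\<close>, again a smooth function.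
\<close>

definition soft_sign :: "real \<Rightarrow> real \<Rightarrow> real" where
  "soft_sign d x = x / sqrt (x\<^sup>2 + d\<^sup>2)"

definition soft_sign' :: "real \<Rightarrow> real \<Rightarrow> real" where
  "soft_sign' d x = d\<^sup>2 / ((x\<^sup>2 + d\<^sup>2) * sqrt (x\<^sup>2 + d\<^sup>2))"

lemma measurable_soft_sign[measurable]:
  "soft_sign d \<in> borel_measurable borel" "soft_sign' d \<in> borel_measurable borel"
  unfolding soft_sign_def[abs_def] soft_sign'_def[abs_def] by simp_all

context
  fixes d :: real
  assumes d: "d > 0"
begin

lemma abs_soft_sign_le: "\<bar>soft_sign d x\<bar> \<le> 1"
proof -
  have "\<bar>x\<bar> \<le> sqrt (x\<^sup>2 + d\<^sup>2)" by (rule real_le_rsqrt) simp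
  moreover have "0 < sqrt (x\<^sup>2 + d\<^sup>2)" using d by (simp add: add_nonneg_pos)
  ultimately show ?thesis by (simp add: soft_sign_def divide_le_eq)
qed

lemma abs_soft_sign'_le: "\<bar>soft_sign' d x\<bar> \<le> 1 / d"
proof -
  have 1: "d \<le> sqrt (x\<^sup>2 + d\<^sup>2)" by (rule real_le_rsqrt) simp
  have "d\<^sup>2 * d \<le> (x\<^sup>2 + d\<^sup>2) * sqrt (x\<^sup>2 + d\<^sup>2)"
    using d 1 by (intro mult_mono) auto
  moreover have "0 < (x\<^sup>2 + d\<^sup>2) * sqrt (x\<^sup>2 + d\<^sup>2)" using d by (simp add: add_nonneg_pos)
  ultimately show ?thesis using d by (simp add: soft_sign'_def field_simps abs_mult)
qed

lemma one_minus_soft_sign_sq: "1 - (soft_sign d x)\<^sup>2 = d\<^sup>2 / (x\<^sup>2 + d\<^sup>2)"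
proof -
  have "0 < x\<^sup>2 + d\<^sup>2" using d by (simp add: add_nonneg_pos)
  then have "x\<^sup>2 + d\<^sup>2 \<noteq> 0" by linarith
  then have "x\<^sup>2 / (x\<^sup>2 + d\<^sup>2) + d\<^sup>2 / (x\<^sup>2 + d\<^sup>2) = 1"
    by (subst add_divide_distrib[symmetric]) (rule divide_self)
  then show ?thesis by (simp add: soft_sign_def power_divide)
qed

lemma has_derivative_soft_sign: "(soft_sign d has_real_derivative soft_sign' d x) (at x)"
proof -
  define R where "R = sqrt (x\<^sup>2 + d\<^sup>2)"
  have pos: "0 < x\<^sup>2 + d\<^sup>2" using d by (simp add: add_nonneg_pos)
  have R: "R > 0" "R\<^sup>2 = x\<^sup>2 + d\<^sup>2" using pos by (simp_all add: R_def)
  have "((\<lambda>x. sqrt (x\<^sup>2 + d\<^sup>2)) has_real_derivative 2 * x * (inverse R / 2)) (at x)"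
    using pos by (auto simp: R_def intro!: derivative_eq_intros)
  from DERIV_divide[OF DERIV_ident this]
  have "((\<lambda>x. x / sqrt (x\<^sup>2 + d\<^sup>2)) has_real_derivative (1 * R - x * (2 * x * (inverse R / 2))) / (R * R)) (at x)"
    using R d by (simp add: R_def mult_ac)
  moreover have "(1 * R - x * (2 * x * (inverse R / 2))) / (R * R) = d\<^sup>2 / (R\<^sup>2 * R)"
  proof -
    have "R * R - x * x = d\<^sup>2" using R by (simp add: power2_eq_square)
    then have "R - x * x / R = d\<^sup>2 / R" using R(1) by (simp add: field_simps)
    then show ?thesis using R(1) by (simp add: field_simps power2_eq_square)
  qed
  ultimately show ?thesis using R by (simp add: soft_sign_def[abs_def] soft_sign'_def R_def)
qed

lemma soft_sign_chain:
  "(f has_real_derivative f') (at t) \<Longrightarrow>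
    ((\<lambda>s. soft_sign d (f s)) has_real_derivative soft_sign' d (f t) * f') (at t)"
  by (rule DERIV_chain2[OF has_derivative_soft_sign])

lemma sgn_soft_sign: "sgn (soft_sign d x) = sgn x"
proof -
  have "0 < sqrt (x\<^sup>2 + d\<^sup>2)" using d by (simp add: add_nonneg_pos)
  then show ?thesis by (simp add: soft_sign_def sgn_divide)
qed

end

lemma abs_product_squares_le:
  fixes u v :: real
  assumes "0 \<le> u" "u \<le> 1" "0 \<le> v" "v \<le> 1"
  shows "u\<^sup>2 + v\<^sup>2 \<le> 1 + u * v"
proof -
  have "u\<^sup>2 + v\<^sup>2 - u * v \<le> u + v - u * v"
    using assms by (simp add: power2_eq_square mult_left_le add_mono)
  also have "\<dots> = 1 - (1 - u) * (1 - v)" by (simp add: algebra_simps)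
  also have "\<dots> \<le> 1" using assms by simp
  finally show ?thesis by simp
qed

text \<open>
  With \<open>u\<close> and \<open>v\<close> the smoothed signs of \<open>x\<close> and \<open>y\<close>, the left-hand side is \<open>(1 - \<bar>u * v\<bar>) / 2\<close>
  if \<open>x * y \<noteq> 0\<close> and \<open>1 / 2\<close> otherwise; in both cases the claim is
  \<open>u\<^sup>2 + v\<^sup>2 \<le> 1 + \<bar>u * v\<bar>\<close>.
\<close>

lemma sign_change_approx:
  assumes d: "d > 0"
  shows "\<bar>of_bool (x * y < 0) - (1 - soft_sign d x * soft_sign d y) / 2\<bar>
     \<le> ((1 - (soft_sign d x)\<^sup>2) + (1 - (soft_sign d y)\<^sup>2)) / 2"
proof -
  define u v where "u = soft_sign d x" and "v = soft_sign d y"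
  have uv: "\<bar>u\<bar> \<le> 1" "\<bar>v\<bar> \<le> 1" unfolding u_def v_def by (rule abs_soft_sign_le[OF d])+
  have sgn: "sgn (x * y) = sgn (u * v)" by (simp add: u_def v_def sgn_mult sgn_soft_sign[OF d])
  then have neg: "x * y < 0 \<longleftrightarrow> u * v < 0" by (metis sgn_less)
  have main: "u\<^sup>2 + v\<^sup>2 \<le> 1 + \<bar>u * v\<bar>" using abs_product_squares_le[of "\<bar>u\<bar>" "\<bar>v\<bar>"] uv by (simp add: abs_mult)
  have uv1: "\<bar>u * v\<bar> \<le> 1" using uv mult_mono[of "\<bar>u\<bar>" 1 "\<bar>v\<bar>" 1] by (simp add: abs_mult)
  have "\<bar>of_bool (u * v < 0) - (1 - u * v) / 2\<bar> \<le> (1 - u\<^sup>2 + (1 - v\<^sup>2)) / 2"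
    using main uv1 by (cases "u * v < 0") (auto simp: abs_if field_simps split: if_splits)
  then show ?thesis unfolding neg u_def[symmetric] v_def[symmetric] .
qed

section \<open>Sums over pairs of neighbours\<close>

text \<open>
  Each coordinate \<open>x i\<close> enters two summands, once as a left and once as a right neighbour, except at the ends
  of the range.
\<close>

lemma has_partials_neighbour_sum:
  fixes g g\<^sub>1 g\<^sub>2 :: "real \<Rightarrow> real \<Rightarrow> real"
  assumes g: "\<And>f\<^sub>1 f\<^sub>2 f\<^sub>1' f\<^sub>2' t. (f\<^sub>1 has_real_derivative f\<^sub>1') (at t) \<Longrightarrow> (f\<^sub>2 has_real_derivative f\<^sub>2') (at t) \<Longrightarrow>
     ((\<lambda>s. g (f\<^sub>1 s) (f\<^sub>2 s)) has_real_derivative g\<^sub>1 (f\<^sub>1 t) (f\<^sub>2 t) * f\<^sub>1' + g\<^sub>2 (f\<^sub>1 t) (f\<^sub>2 t) * f\<^sub>2') (at t)"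
  shows "has_partials {0..int T} (\<lambda>x. \<Sum>k = 0..<T. g (x (int k)) (x (int k + 1)))
     (\<lambda>i x. (if i < int T then g\<^sub>1 (x i) (x (i + 1)) else 0) + (if 0 < i then g\<^sub>2 (x (i - 1)) (x i) else 0))"
  unfolding has_partials_def
proof (intro allI impI)
  fix x :: "real \<Rightarrow> int \<Rightarrow> real" and x' t
  assume x: "\<forall>i\<in>{0..int T}. ((\<lambda>s. x s i) has_real_derivative x' i) (at t)"
  let ?A = "\<lambda>i. g\<^sub>1 (x t i) (x t (i + 1)) * x' i" and ?B = "\<lambda>i. g\<^sub>2 (x t (i - 1)) (x t i) * x' i"
  have "((\<lambda>s. \<Sum>k = 0..<T. g (x s (int k)) (x s (int k + 1))) has_real_derivative
      (\<Sum>k = 0..<T. ?A (int k) + g\<^sub>2 (x t (int k)) (x t (int k + 1)) * x' (int k + 1))) (at t)"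
    by (intro DERIV_sum g) (use x in auto)
  also have "(\<Sum>k = 0..<T. ?A (int k) + g\<^sub>2 (x t (int k)) (x t (int k + 1)) * x' (int k + 1))
     = (\<Sum>i\<in>{0..int T}. if i < int T then ?A i else 0) + (\<Sum>i\<in>{0..int T}. if 0 < i then ?B i else 0)"
  proof -
    have "(\<Sum>i\<in>{0..int T}. if i < int T then ?A i else 0) = (\<Sum>i\<in>{0..<int T}. ?A i)"
      by (intro sum.mono_neutral_cong_right) auto
    also have "\<dots> = (\<Sum>k = 0..<T. ?A (int k))"
      by (rule sum.reindex_bij_witness[where i=int and j=nat]) auto
    finally have 1: "(\<Sum>i\<in>{0..int T}. if i < int T then ?A i else 0) = (\<Sum>k = 0..<T. ?A (int k))" .
    have "(\<Sum>i\<in>{0..int T}. if 0 < i then ?B i else 0) = (\<Sum>i\<in>{1..int T}. ?B i)"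
      by (intro sum.mono_neutral_cong_right) auto
    also have "\<dots> = (\<Sum>k = 0..<T. ?B (int k + 1))"
      by (rule sum.reindex_bij_witness[where i="\<lambda>k. int k + 1" and j="\<lambda>i. nat (i - 1)"]) auto
    finally show ?thesis unfolding 1 by (simp add: sum.distrib)
  qed
  also have "\<dots> = (\<Sum>i\<in>{0..int T}. ((if i < int T then g\<^sub>1 (x t i) (x t (i + 1)) else 0) + (if 0 < i then g\<^sub>2 (x t (i - 1)) (x t i) else 0)) * x' i)"
    unfolding sum.distrib[symmetric] by (intro sum.cong) (auto simp: distrib_right)
  finally show "((\<lambda>s. \<Sum>k = 0..<T. g (x s (int k)) (x s (int k + 1))) has_real_derivative
     (\<Sum>i\<in>{0..int T}. ((if i < int T then g\<^sub>1 (x t i) (x t (i + 1)) else 0) + (if 0 < i then g\<^sub>2 (x t (i - 1)) (x t i) else 0)) * x' i)) (at t)" .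
qed

text \<open>
  Every partial derivative is at most \<open>2 * K\<close>, so the squared gradient is at most
  \<open>(T + 1) * 4 * K\<^sup>2 \<le> 8 * K\<^sup>2 * T\<close>, linear in \<open>T\<close>. A deviation of order \<open>T\<close> therefore has probability
  exponentially small in \<open>T\<close>.
\<close>

lemma neighbour_sum_concentration:
  fixes g g\<^sub>1 g\<^sub>2 :: "real \<Rightarrow> real \<Rightarrow> real" and Y :: "int \<Rightarrow> 'a \<Rightarrow> real"
  assumes "centered_gaussian_vector M Y {0..int T}"
    and var: "\<And>a. centered_gaussian_vector.variance_of M Y {0..int T} a \<le> L * (\<Sum>i = 0..int T. (a i)\<^sup>2)"
    and g: "\<And>f\<^sub>1 f\<^sub>2 f\<^sub>1' f\<^sub>2' t. (f\<^sub>1 has_real_derivative f\<^sub>1') (at t) \<Longrightarrow> (f\<^sub>2 has_real_derivative f\<^sub>2') (at t) \<Longrightarrow>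
     ((\<lambda>s. g (f\<^sub>1 s) (f\<^sub>2 s)) has_real_derivative g\<^sub>1 (f\<^sub>1 t) (f\<^sub>2 t) * f\<^sub>1' + g\<^sub>2 (f\<^sub>1 t) (f\<^sub>2 t) * f\<^sub>2') (at t)"
    and meas: "case_prod g \<in> borel_measurable (borel \<Otimes>\<^sub>M borel)" "case_prod g\<^sub>1 \<in> borel_measurable (borel \<Otimes>\<^sub>M borel)"
       "case_prod g\<^sub>2 \<in> borel_measurable (borel \<Otimes>\<^sub>M borel)"
    and bound: "\<And>x y. \<bar>g x y\<bar> \<le> B" "\<And>x y. \<bar>g\<^sub>1 x y\<bar> \<le> K" "\<And>x y. \<bar>g\<^sub>2 x y\<bar> \<le> K"
    and pos: "L > 0" "K > 0" "r \<ge> 0"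
  defines "S \<equiv> \<lambda>\<omega>. \<Sum>k = 0..<T. g (Y (int k) \<omega>) (Y (int k + 1) \<omega>)"
  shows "measure M {\<omega> \<in> space M. \<bar>S \<omega> - (LINT \<omega>|M. S \<omega>)\<bar> \<ge> r * T}
     \<le> 2 * exp (- (r\<^sup>2 / (4 * pi\<^sup>2 * L * K\<^sup>2)) * T)"
proof -
  interpret centered_gaussian_vector M Y "{0..int T}" by fact
  show ?thesis
  proof (cases "T = 0")
    case True
    then show ?thesis using prob_le_1 by (auto intro: order_trans)
  next
    case False
    let ?J = "{0..int T}"
    let ?F = "\<lambda>x. \<Sum>k = 0..<T. g (x (int k)) (x (int k + 1))"
    let ?D = "\<lambda>i x. (if i < int T then g\<^sub>1 (x i) (x (i + 1)) else 0) + (if 0 < i then g\<^sub>2 (x (i - 1)) (x i) else 0)"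
    have comp: "(\<lambda>x. x i) \<in> borel_measurable (\<Pi>\<^sub>M i\<in>?J. borel)" if "0 \<le> i" "i \<le> int T" for i
      using that by (intro measurable_component_singleton) auto
    have pair: "(\<lambda>x. f (x i) (x j)) \<in> borel_measurable (\<Pi>\<^sub>M i\<in>?J. borel)"
      if "case_prod f \<in> borel_measurable (borel \<Otimes>\<^sub>M borel)" "0 \<le> i" "i \<le> int T" "0 \<le> j" "j \<le> int T"
      for f :: "real \<Rightarrow> real \<Rightarrow> real" and i j
      using measurable_compose[OF measurable_Pair[OF comp comp] that(1)] that by simp
    have F: "?F \<in> borel_measurable (\<Pi>\<^sub>M i\<in>?J. borel)"
      by (intro borel_measurable_sum pair meas) auto
    have D: "?D i \<in> borel_measurable (\<Pi>\<^sub>M i\<in>?J. borel)" if "i \<in> ?J" for i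
      using that pair[OF meas(2), of i "i + 1"] pair[OF meas(3), of "i - 1" i]
      by (cases "i < int T"; cases "0 < i") auto
    have Fb: "\<bar>?F x\<bar> \<le> T * B" for x
      using sum_bounded_above[of "{0..<T}" "\<lambda>k. \<bar>g (x (int k)) (x (int k + 1))\<bar>" B] bound
      by (auto intro!: order_trans[OF sum_abs])
    have grad: "(\<Sum>i\<in>?J. (?D i x)\<^sup>2) \<le> 8 * K\<^sup>2 * T" for x
    proof -
      have "(?D i x)\<^sup>2 \<le> 4 * K\<^sup>2" for i
      proof -
        have "\<bar>?D i x\<bar> \<le> 2 * K"
          using bound(2)[of "x i" "x (i + 1)"] bound(3)[of "x (i - 1)" "x i"] pos by auto
        then have "\<bar>?D i x\<bar>\<^sup>2 \<le> (2 * K)\<^sup>2" by (intro power_mono) auto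
        then show ?thesis by (simp add: power_mult_distrib)
      qed
      then have "(\<Sum>i\<in>?J. (?D i x)\<^sup>2) \<le> of_nat (card ?J) * (4 * K\<^sup>2)" by (intro sum_bounded_above)
      also have "\<dots> \<le> (2 * T) * (4 * K\<^sup>2)"
        using False by (intro mult_right_mono) auto
      finally show ?thesis by (simp add: mult_ac)
    qed
    have "prob {\<omega> \<in> space M. \<bar>(\<lambda>\<omega>. ?F (\<lambda>i\<in>?J. Y i \<omega>)) \<omega> - expectation (\<lambda>\<omega>. ?F (\<lambda>i\<in>?J. Y i \<omega>))\<bar> \<ge> r * T}
      \<le> 2 * exp (- (2 * (r * T)\<^sup>2) / (pi\<^sup>2 * L * (8 * K\<^sup>2 * T)))"
      by (rule gaussian_concentration[OF F D Fb has_partials_neighbour_sum[OF g] grad var])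
         (use pos False in auto)
    also have "(\<lambda>\<omega>. ?F (\<lambda>i\<in>?J. Y i \<omega>)) = S"
      unfolding S_def by (intro ext sum.cong) auto
    also have "- (2 * (r * T)\<^sup>2) / (pi\<^sup>2 * L * (8 * K\<^sup>2 * T)) = - (r\<^sup>2 / (4 * pi\<^sup>2 * L * K\<^sup>2)) * T"
      using pos False by (simp add: field_simps power2_eq_square)
    finally show ?thesis .
  qed
qed

section \<open>Concentration of the number of sign changes\<close>

text \<open>
  The one-dimensional consequence of stationarity: project the shifted and the unshifted law to coordinate \<open>0\<close>.
\<close>

lemma stationary_marginal:
  assumes "stationary M Y"
  shows "distr M borel (Y k) = distr M borel (Y 0)"
proof -
  let ?P = "\<Pi>\<^sub>M k\<in>(UNIV::int set). (borel :: real measure)"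
  have [measurable]: "Y k \<in> borel_measurable M" for k using assms by (simp add: stationary_def)
  have shift: "(\<lambda>\<omega> j. Y (j + h) \<omega>) \<in> measurable M ?P" for h by (rule measurable_abs_UNIV) simp
  have "distr (distr M ?P (\<lambda>\<omega> j. Y (j + k) \<omega>)) borel (\<lambda>f. f 0)
      = distr (distr M ?P (\<lambda>\<omega> j. Y (j + 0) \<omega>)) borel (\<lambda>f. f 0)"
    using assms by (simp add: stationary_def)
  then show ?thesis
    using shift[of k] shift[of 0] by (simp add: distr_distr comp_def)
qed

text \<open>
  The integrand tends to \<open>0\<close> with \<open>d\<close> wherever \<open>Z \<noteq> 0\<close>, and it is bounded by \<open>1\<close>.
\<close>

lemma soft_sign_sq_expectation:
  fixes Z :: "'a \<Rightarrow> real"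
  assumes "prob_space M" and [measurable]: "Z \<in> borel_measurable M" and nz: "AE \<omega> in M. Z \<omega> \<noteq> 0" and \<epsilon>: "\<epsilon> > 0"
  shows "\<exists>d>0. (LINT \<omega>|M. 1 - (soft_sign d (Z \<omega>))\<^sup>2) < \<epsilon>"
proof -
  interpret prob_space M by fact
  define d where "d n = inverse (real (Suc n))" for n
  have d: "d n > 0" for n by (simp add: d_def)
  have d0: "d \<longlonglongrightarrow> 0" unfolding d_def[abs_def] by (rule LIMSEQ_inverse_real_of_nat)
  have "(\<lambda>n. LINT \<omega>|M. 1 - (soft_sign (d n) (Z \<omega>))\<^sup>2) \<longlonglongrightarrow> (LINT \<omega>|M. 0)"
  proof (rule integral_dominated_convergence[where w="\<lambda>_. 1"])
    show "AE \<omega> in M. (\<lambda>n. 1 - (soft_sign (d n) (Z \<omega>))\<^sup>2) \<longlonglongrightarrow> 0"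
      using nz
    proof eventually_elim
      case (elim \<omega>)
      then show ?case unfolding one_minus_soft_sign_sq[OF d]
        by (auto intro!: tendsto_eq_intros d0)
    qed
    show "AE \<omega> in M. norm (1 - (soft_sign (d n) (Z \<omega>))\<^sup>2) \<le> 1" for n
      using abs_soft_sign_le[OF d[of n]] by (simp add: abs_square_le_1)
  qed auto
  then have "(\<lambda>n. LINT \<omega>|M. 1 - (soft_sign (d n) (Z \<omega>))\<^sup>2) \<longlonglongrightarrow> 0" by simp
  from order_tendstoD(2)[OF this \<epsilon>] obtain n where "(LINT \<omega>|M. 1 - (soft_sign (d n) (Z \<omega>))\<^sup>2) < \<epsilon>"
    by (auto simp: eventually_sequentially)
  with d show ?thesis by blast
qed

lemma sign_changes_approx:
  assumes "d > 0"
  shows "\<bar>sign_changes Y T \<omega> - (\<Sum>k = 0..<T. (1 - soft_sign d (Y (int k) \<omega>) * soft_sign d (Y (int k + 1) \<omega>)) / 2)\<bar>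
    \<le> (\<Sum>k = 0..<T. ((1 - (soft_sign d (Y (int k) \<omega>))\<^sup>2) + (1 - (soft_sign d (Y (int k + 1) \<omega>))\<^sup>2)) / 2)"
  unfolding sign_changes_def sum_subtractf[symmetric]
  by (rule order_trans[OF sum_abs]) (intro sum_mono sign_change_approx assms)

text \<open>
  If \<open>F\<close> and \<open>H\<close> both stay within \<open>r\<close> of their means, then \<open>N\<close> stays within \<open>r + r + 2 * E H\<close> of its mean,
  and this is less than \<open>4 * r\<close>.
\<close>

lemma (in prob_space) deviation_transfer:
  fixes N F H :: "'a \<Rightarrow> real"
  assumes int: "integrable M N" "integrable M F" "integrable M H"
    and le: "\<And>\<omega>. \<bar>N \<omega> - F \<omega>\<bar> \<le> H \<omega>" and H: "expectation H \<le> r / 2" and r: "r > 0"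
  shows "prob {\<omega> \<in> space M. \<bar>N \<omega> - expectation N\<bar> \<ge> 4 * r}
    \<le> prob {\<omega> \<in> space M. \<bar>F \<omega> - expectation F\<bar> \<ge> r} + prob {\<omega> \<in> space M. \<bar>H \<omega> - expectation H\<bar> \<ge> r}"
proof -
  have [measurable]: "N \<in> borel_measurable M" "F \<in> borel_measurable M" "H \<in> borel_measurable M"
    using int by auto
  have "\<bar>expectation N - expectation F\<bar> \<le> expectation (\<lambda>\<omega>. \<bar>N \<omega> - F \<omega>\<bar>)"
    using int integral_abs_bound[of M "\<lambda>\<omega>. N \<omega> - F \<omega>"] by simp
  also have "\<dots> \<le> expectation H"
    by (intro integral_mono) (use int le in auto)
  finally have mean: "\<bar>expectation N - expectation F\<bar> \<le> expectation H" .
  have "{\<omega> \<in> space M. \<bar>N \<omega> - expectation N\<bar> \<ge> 4 * r}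
     \<subseteq> {\<omega> \<in> space M. \<bar>F \<omega> - expectation F\<bar> \<ge> r} \<union> {\<omega> \<in> space M. \<bar>H \<omega> - expectation H\<bar> \<ge> r}"
  proof safe
    fix \<omega> assume "4 * r \<le> \<bar>N \<omega> - expectation N\<bar>" "\<not> r \<le> \<bar>H \<omega> - expectation H\<bar>"
    then show "r \<le> \<bar>F \<omega> - expectation F\<bar>" using le[of \<omega>] mean H r by linarith
  qed
  then have "prob {\<omega> \<in> space M. \<bar>N \<omega> - expectation N\<bar> \<ge> 4 * r}
     \<le> prob ({\<omega> \<in> space M. \<bar>F \<omega> - expectation F\<bar> \<ge> r} \<union> {\<omega> \<in> space M. \<bar>H \<omega> - expectation H\<bar> \<ge> r})"
    by (intro finite_measure_mono) auto
  also have "\<dots> \<le> prob {\<omega> \<in> space M. \<bar>F \<omega> - expectation F\<bar> \<ge> r} + prob {\<omega> \<in> space M. \<bar>H \<omega> - expectation H\<bar> \<ge> r}"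
    by (intro measure_Un_le) auto
  finally show ?thesis .
qed

lemma sign_changes_concentration:
  fixes Y :: "int \<Rightarrow> 'a \<Rightarrow> real"
  assumes "prob_space M" and "stationary M Y"
    and cg: "\<And>T. centered_gaussian_vector M Y {0..int T}"
    and var: "\<And>T a. centered_gaussian_vector.variance_of M Y {0..int T} a \<le> L * (\<Sum>i = 0..int T. (a i)\<^sup>2)"
    and L: "L > 0" and nz: "AE \<omega> in M. Y 0 \<omega> \<noteq> 0" and \<eta>: "\<eta> > 0"
  shows "\<exists>c>0. \<forall>T. measure M {\<omega> \<in> space M.
         \<bar>sign_changes Y T \<omega> - (LINT \<omega>'|M. sign_changes Y T \<omega>')\<bar> \<ge> \<eta> * real T} \<le> 4 * exp (- c * real T)"
proof -
  interpret prob_space M by fact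
  have [measurable]: "Y k \<in> borel_measurable M" for k using assms by (simp add: stationary_def)
  \<comment> \<open>The two functionals may fluctuate by \<open>\<eta> / 4\<close> per step each, and the mean error, which enters twice, is below
    \<open>\<eta> / 8\<close> per step, so the total stays below \<open>\<eta>\<close>.\<close>
  obtain d where d: "d > 0" and small: "expectation (\<lambda>\<omega>. 1 - (soft_sign d (Y 0 \<omega>))\<^sup>2) < \<eta> / 8"
    using soft_sign_sq_expectation[OF \<open>prob_space M\<close> _ nz, of "\<eta> / 8"] \<eta> by auto
  let ?\<sigma> = "soft_sign d" and ?\<sigma>' = "soft_sign' d"
  define c where "c = (\<eta> / 4)\<^sup>2 / (4 * pi\<^sup>2 * L * (1 / d)\<^sup>2)"
  have c: "c > 0" using \<eta> L d by (simp add: c_def)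
  note chain = soft_sign_chain[OF d]
  have \<sigma>1: "\<bar>?\<sigma> x\<bar> \<le> 1" for x by (rule abs_soft_sign_le[OF d])
  have sq1: "0 \<le> 1 - (?\<sigma> x)\<^sup>2" "1 - (?\<sigma> x)\<^sup>2 \<le> 1" for x
    using \<sigma>1[of x] by (simp_all add: abs_square_le_1)
  have prod1: "\<bar>?\<sigma> x * ?\<sigma> y\<bar> \<le> 1" for x y
    using mult_mono[OF \<sigma>1[of x] \<sigma>1[of y]] by (simp add: abs_mult)
  have prod': "\<bar>?\<sigma>' x * ?\<sigma> y\<bar> \<le> 1 / d" for x y
    using mult_mono[OF abs_soft_sign'_le[OF d, of x] \<sigma>1[of y]] d by (simp add: abs_mult)
  have "measure M {\<omega> \<in> space M. \<bar>sign_changes Y T \<omega> - (LINT \<omega>'|M. sign_changes Y T \<omega>')\<bar> \<ge> \<eta> * real T} \<le> 4 * exp (- c * real T)" for T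
  proof (cases "T = 0")
    case True
    then show ?thesis using prob_le_1 by (auto intro: order_trans)
  next
    case False
    define F where "F \<omega> = (\<Sum>k = 0..<T. (\<lambda>x y. (1 - ?\<sigma> x * ?\<sigma> y) / 2) (Y (int k) \<omega>) (Y (int k + 1) \<omega>))" for \<omega>
    define H where "H \<omega> = (\<Sum>k = 0..<T. (\<lambda>x y. ((1 - (?\<sigma> x)\<^sup>2) + (1 - (?\<sigma> y)\<^sup>2)) / 2) (Y (int k) \<omega>) (Y (int k + 1) \<omega>))" for \<omega>
    have F: "prob {\<omega> \<in> space M. \<bar>F \<omega> - expectation F\<bar> \<ge> \<eta> / 4 * T} \<le> 2 * exp (- c * T)"
      unfolding F_def c_def
    proof (rule neighbour_sum_concentration[OF cg var, where B=1 and
        g\<^sub>1="\<lambda>x y. - (?\<sigma>' x * ?\<sigma> y) / 2" and g\<^sub>2="\<lambda>x y. - (?\<sigma>' y * ?\<sigma> x) / 2"])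
      show "((\<lambda>s. (1 - ?\<sigma> (f\<^sub>1 s) * ?\<sigma> (f\<^sub>2 s)) / 2) has_real_derivative
          - (?\<sigma>' (f\<^sub>1 t) * ?\<sigma> (f\<^sub>2 t)) / 2 * f\<^sub>1' + - (?\<sigma>' (f\<^sub>2 t) * ?\<sigma> (f\<^sub>1 t)) / 2 * f\<^sub>2') (at t)"
        if "(f\<^sub>1 has_real_derivative f\<^sub>1') (at t)" "(f\<^sub>2 has_real_derivative f\<^sub>2') (at t)" for f\<^sub>1 f\<^sub>2 f\<^sub>1' f\<^sub>2' t
        using DERIV_cdivide[OF DERIV_diff[OF DERIV_const[of 1] DERIV_mult[OF chain[OF that(1)] chain[OF that(2)]]], of 2]
        by (rule DERIV_cong) (simp add: field_simps)
      show "\<bar>(1 - ?\<sigma> x * ?\<sigma> y) / 2\<bar> \<le> 1" for x y using prod1[of x y] by simp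
      show "\<bar>- (?\<sigma>' x * ?\<sigma> y) / 2\<bar> \<le> 1 / d" "\<bar>- (?\<sigma>' y * ?\<sigma> x) / 2\<bar> \<le> 1 / d" for x y
        using prod'[of x y] prod'[of y x] d by auto
    qed (use L d \<eta> in auto)
    have H: "prob {\<omega> \<in> space M. \<bar>H \<omega> - expectation H\<bar> \<ge> \<eta> / 4 * T} \<le> 2 * exp (- c * T)"
      unfolding H_def c_def
    proof (rule neighbour_sum_concentration[OF cg var, where B=1 and
        g\<^sub>1="\<lambda>x y. - (?\<sigma>' x * ?\<sigma> x)" and g\<^sub>2="\<lambda>x y. - (?\<sigma>' y * ?\<sigma> y)"])
      show "((\<lambda>s. ((1 - (?\<sigma> (f\<^sub>1 s))\<^sup>2) + (1 - (?\<sigma> (f\<^sub>2 s))\<^sup>2)) / 2) has_real_derivative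
          - (?\<sigma>' (f\<^sub>1 t) * ?\<sigma> (f\<^sub>1 t)) * f\<^sub>1' + - (?\<sigma>' (f\<^sub>2 t) * ?\<sigma> (f\<^sub>2 t)) * f\<^sub>2') (at t)"
        if "(f\<^sub>1 has_real_derivative f\<^sub>1') (at t)" "(f\<^sub>2 has_real_derivative f\<^sub>2') (at t)" for f\<^sub>1 f\<^sub>2 f\<^sub>1' f\<^sub>2' t
        using DERIV_cdivide[OF DERIV_add[OF DERIV_diff[OF DERIV_const[of 1] DERIV_mult[OF chain[OF that(1)] chain[OF that(1)]]]
          DERIV_diff[OF DERIV_const[of 1] DERIV_mult[OF chain[OF that(2)] chain[OF that(2)]]]], of 2]
        unfolding power2_eq_square by (rule DERIV_cong) (simp add: field_simps)
      show "\<bar>((1 - (?\<sigma> x)\<^sup>2) + (1 - (?\<sigma> y)\<^sup>2)) / 2\<bar> \<le> 1" for x y using sq1[of x] sq1[of y] by simp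
      show "\<bar>- (?\<sigma>' x * ?\<sigma> x)\<bar> \<le> 1 / d" "\<bar>- (?\<sigma>' y * ?\<sigma> y)\<bar> \<le> 1 / d" for x y
        using prod'[of x x] prod'[of y y] by auto
    qed (use L d \<eta> in auto)
    have int_sq: "integrable M (\<lambda>\<omega>. 1 - (?\<sigma> (Y k \<omega>))\<^sup>2)" for k
      by (rule integrable_const_bound[where B=1]) (use sq1 in auto)
    have int_prod: "integrable M (\<lambda>\<omega>. ?\<sigma> (Y j \<omega>) * ?\<sigma> (Y k \<omega>))" for j k
      by (rule integrable_const_bound[where B=1]) (use prod1 in auto)
    have int: "integrable M (sign_changes Y T)" "integrable M F" "integrable M H"
    proof -
      have "integrable M (\<lambda>\<omega>. of_bool (Y j \<omega> * Y k \<omega> < 0) :: real)" for j k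
        by (rule integrable_const_bound[where B=1]) auto
      then show "integrable M (sign_changes Y T)" unfolding sign_changes_def[abs_def]
        by (intro Bochner_Integration.integrable_sum)
      show "integrable M F" unfolding F_def[abs_def] using int_prod by auto
      show "integrable M H" unfolding H_def[abs_def] using int_sq
        by (intro Bochner_Integration.integrable_sum integrable_divide Bochner_Integration.integrable_add)
    qed
    define e where "e = expectation (\<lambda>\<omega>. 1 - (?\<sigma> (Y 0 \<omega>))\<^sup>2)"
    have marg: "expectation (\<lambda>\<omega>. 1 - (?\<sigma> (Y k \<omega>))\<^sup>2) = e" for k
    proof -
      have "(LINT x|distr M borel (Y k). 1 - (?\<sigma> x)\<^sup>2) = (LINT x|distr M borel (Y 0). 1 - (?\<sigma> x)\<^sup>2)"
        using stationary_marginal[OF \<open>stationary M Y\<close>, of k] by simp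
      then show ?thesis unfolding e_def by (subst (asm) (1 2) integral_distr) auto
    qed
    have "expectation H = (\<Sum>k = 0..<T. (expectation (\<lambda>\<omega>. 1 - (?\<sigma> (Y (int k) \<omega>))\<^sup>2) + expectation (\<lambda>\<omega>. 1 - (?\<sigma> (Y (int k + 1) \<omega>))\<^sup>2)) / 2)"
      unfolding H_def by (simp only: Bochner_Integration.integral_sum Bochner_Integration.integral_add integral_divide_zero int_sq
         Bochner_Integration.integrable_add integrable_divide)
    also have "\<dots> = T * e"
      unfolding marg by simp
    also have "\<dots> \<le> (\<eta> / 4 * T) / 2"
      using small mult_left_mono[of e "\<eta> / 8" "real T"] by (simp add: mult_ac e_def)
    finally have EH: "expectation H \<le> (\<eta> / 4 * T) / 2" .
    have le: "\<bar>sign_changes Y T \<omega> - F \<omega>\<bar> \<le> H \<omega>" for \<omega>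
      unfolding F_def H_def by (rule sign_changes_approx[OF d])
    have "prob {\<omega> \<in> space M. \<bar>sign_changes Y T \<omega> - expectation (sign_changes Y T)\<bar> \<ge> 4 * (\<eta> / 4 * T)}
      \<le> prob {\<omega> \<in> space M. \<bar>F \<omega> - expectation F\<bar> \<ge> \<eta> / 4 * T} + prob {\<omega> \<in> space M. \<bar>H \<omega> - expectation H\<bar> \<ge> \<eta> / 4 * T}"
      by (rule deviation_transfer[OF int le EH]) (use \<eta> False in simp)
    with F H show ?thesis by simp
  qed
  with c show ?thesis by blast
qed

text \<open>
  A nondegenerate normal law has no atoms, and a constant variable with mean \<open>0\<close> is \<open>0\<close>.
\<close>

lemma gaussian_AE_nonzero_or_zero:
  assumes "prob_space M" "gaussian_rv M Z" "(LINT \<omega>|M. Z \<omega>) = 0"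
  shows "(AE \<omega> in M. Z \<omega> \<noteq> 0) \<or> (AE \<omega> in M. Z \<omega> = 0)"
proof -
  interpret prob_space M by fact
  have [measurable]: "Z \<in> borel_measurable M" using assms by (simp add: gaussian_rv_def)
  consider \<mu> \<sigma> where "\<sigma> > 0" "distributed M lborel Z (\<lambda>x. ennreal (normal_density \<mu> \<sigma> x))" | \<mu> where "AE \<omega> in M. Z \<omega> = \<mu>"
    using assms by (auto simp: gaussian_rv_def)
  then show ?thesis
  proof cases
    case 1
    have "AE x in lborel. x \<noteq> (0::real)" by (rule AE_lborel_singleton)
    then have "AE x in density lborel (\<lambda>x. ennreal (normal_density \<mu> \<sigma> x)). x \<noteq> 0"
      by (subst AE_density) auto
    then have "AE x in distr M lborel Z. x \<noteq> 0" by (simp only: distributed_distr_eq_density[OF 1(2)])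
    then show ?thesis by (subst (asm) AE_distr_iff) auto
  next
    case 2
    then have "(LINT \<omega>|M. Z \<omega>) = (LINT \<omega>|M. \<mu>)" by (intro integral_cong_AE) auto
    with 2 assms show ?thesis by (simp add: prob_space)
  qed
qed

theorem theorem1p4:
  fixes M :: "'a measure" and Y :: "int \<Rightarrow> 'a \<Rightarrow> real"
    and \<rho> :: "real measure" and p :: "real \<Rightarrow> real"
  assumes "prob_space M"
    and "gaussian_family M Y"
    and "centered M Y"
    and "stationary M Y"
    and "spectral_measure M Y \<rho>"
    and "continuous_on {-pi..pi} p"
    and "\<And>x. x \<in> {-pi..pi} \<Longrightarrow> p x \<ge> 0"
    and "\<rho> = density lborel (\<lambda>x. ennreal (p x * indicator {-pi..pi} x))"
  shows "\<exists>(C::real) (c :: real \<Rightarrow> real). (\<forall>\<eta>>0. c \<eta> > 0) \<and>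
    (\<forall>\<eta>>0. \<forall>T::nat.
       measure M {\<omega> \<in> space M.
         \<bar>sign_changes Y T \<omega> - (LINT \<omega>'|M. sign_changes Y T \<omega>')\<bar> \<ge> \<eta> * real T}
       \<le> C * exp (- c \<eta> * real T))"
proof -
  interpret prob_space M by fact
  have [measurable]: "Y k \<in> borel_measurable M" for k using assms by (simp add: stationary_def)
  have "\<exists>c>0. \<forall>T. measure M {\<omega> \<in> space M.
         \<bar>sign_changes Y T \<omega> - (LINT \<omega>'|M. sign_changes Y T \<omega>')\<bar> \<ge> \<eta> * real T} \<le> 4 * exp (- c * real T)"
    if \<eta>: "\<eta> > 0" for \<eta>
  proof -
    have "gaussian_rv M (Y 0)"
      using assms(2)[unfolded gaussian_family_def, rule_format, of "{0}" "\<lambda>_. 1"] by simp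
    moreover have "expectation (Y 0) = 0" using \<open>centered M Y\<close> by (simp add: centered_def)
    ultimately consider "AE \<omega> in M. Y 0 \<omega> \<noteq> 0" | "AE \<omega> in M. Y 0 \<omega> = 0"
      using gaussian_AE_nonzero_or_zero[OF \<open>prob_space M\<close>] by blast
    then show ?thesis
    proof cases
      case 1
      have cg: "centered_gaussian_vector M Y {0..int T}" for T
        by unfold_locales (use assms in auto)
      have "bounded (p ` {-pi..pi})"
        by (intro compact_imp_bounded compact_continuous_image assms) simp
      then obtain S where S: "S > 0" "\<And>x. x \<in> {-pi..pi} \<Longrightarrow> \<bar>p x\<bar> \<le> S"
        by (auto simp: bounded_pos)
      show ?thesis
      proof (rule sign_changes_concentration[OF \<open>prob_space M\<close> \<open>stationary M Y\<close> cg _ _ 1 \<eta>])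
        show "centered_gaussian_vector.variance_of M Y {0..int T} a \<le> 2 * pi * S * (\<Sum>i = 0..int T. (a i)\<^sup>2)" for T a
          unfolding centered_gaussian_vector.variance_of_def[OF cg]
          by (rule variance_le_spectral_density[OF cg assms(5,6) _ _ assms(8)]) (use S(2) assms(7) in \<open>force simp: abs_le_iff\<close>)+
        show "2 * pi * S > 0" using S by simp
      qed
    next
      case 2
      have zero: "AE \<omega> in M. Y k \<omega> = 0" for k
      proof -
        have "AE x in distr M borel (Y 0). x = 0" using 2 by (subst AE_distr_iff) auto
        then have "AE x in distr M borel (Y k). x = 0"
          by (simp only: stationary_marginal[OF \<open>stationary M Y\<close>, of k])
        then show ?thesis by (subst (asm) AE_distr_iff) auto
      qed
      have N0: "AE \<omega> in M. sign_changes Y T \<omega> = 0" for T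
      proof -
        have "AE \<omega> in M. \<forall>k. Y k \<omega> = 0" using zero by (simp add: AE_all_countable)
        then show ?thesis by eventually_elim (simp add: sign_changes_def)
      qed
      have [measurable]: "sign_changes Y T \<in> borel_measurable M" for T
        unfolding sign_changes_def[abs_def] by measurable
      have "measure M {\<omega> \<in> space M.
         \<bar>sign_changes Y T \<omega> - (LINT \<omega>'|M. sign_changes Y T \<omega>')\<bar> \<ge> \<eta> * real T} \<le> 4 * exp (- 1 * real T)" for T
      proof (cases "T = 0")
        case True
        then show ?thesis using prob_le_1 by (auto intro: order_trans)
      next
        case False
        have "expectation (sign_changes Y T) = expectation (\<lambda>_. 0)"
          by (rule integral_cong_AE) (use N0 in auto)
        then have "AE \<omega> in M. \<omega> \<notin> {\<omega> \<in> space M. \<bar>sign_changes Y T \<omega> - expectation (sign_changes Y T)\<bar> \<ge> \<eta> * real T}"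
          using N0[of T] mult_pos_pos[OF \<eta>, of "real T"] False by auto
        then have "prob {\<omega> \<in> space M. \<bar>sign_changes Y T \<omega> - expectation (sign_changes Y T)\<bar> \<ge> \<eta> * real T} = 0"
          by (subst prob_eq_0) auto
        then show ?thesis by simp
      qed
      then show ?thesis by (intro exI[of _ 1]) auto
    qed
  qed
  then have "\<forall>\<eta>. \<exists>c. \<eta> > 0 \<longrightarrow> c > 0 \<and> (\<forall>T. measure M {\<omega> \<in> space M.
         \<bar>sign_changes Y T \<omega> - (LINT \<omega>'|M. sign_changes Y T \<omega>')\<bar> \<ge> \<eta> * real T} \<le> 4 * exp (- c * real T))"
    by blast
  from choice[OF this] obtain c where c: "\<forall>\<eta>. \<eta> > 0 \<longrightarrow> c \<eta> > 0 \<and> (\<forall>T. measure M {\<omega> \<in> space M.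
         \<bar>sign_changes Y T \<omega> - (LINT \<omega>'|M. sign_changes Y T \<omega>')\<bar> \<ge> \<eta> * real T} \<le> 4 * exp (- c \<eta> * real T))"
    by (elim exE)
  \<comment> \<open>Two two-sided tail bounds add up to the factor \<open>4\<close>; it also covers \<open>T = 0\<close>, where the event is certain.\<close>
  show ?thesis
    by (rule exI[of _ 4], rule exI[of _ c], intro conjI allI impI)
       (rule c[rule_format, THEN conjunct1], assumption, rule c[rule_format, THEN conjunct2, rule_format], assumption)
qed

end
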